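(* Let $n$ be any nonnegative integer. Then: (1) the map $Q_{out}:(\mathrm{Hol}_n(\overline{\mathbb{D}}), \|\cdot\|_{\infty})\rightarrow (\mathfrak{F}, \|\cdot\|_{\infty})$ is continuous; (2) the map $Q_{inn}:(\mathrm{Hol}_n(\overline{\mathbb{D}}), \|\cdot\|_{\infty})\rightarrow (\mathfrak{I}, \|\cdot\|_{\infty})$ is not continuous; (3) both maps $Q_{inn}:(\mathrm{Hol}_n(\overline{\mathbb{D}}), \|\cdot\|_{\infty})\rightarrow (\mathfrak{I}, \|\cdot\|_{2})$ and $Q_{out}:(\mathrm{Hol}_n(\overline{\mathbb{D}}), \|\cdot\|_{\infty})\rightarrow (\mathfrak{F}, \|\cdot\|_{2})$ are continuous. Here each space carries the metric induced by the indicated norm.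
   Context: $\mathbb{D}$ is the open unit disc, $\mathbb{T}$ the unit circle, $H^{\infty}$ the Banach algebra of bounded analytic functions on $\mathbb{D}$ with the supremum norm $\|f\|_{\infty}=\sup_{z\in\mathbb{D}}|f(z)|$. $H^2$ is the classical Hardy space on $\mathbb{D}$ with norm $\|\cdot\|_2$. An inner function is a bounded analytic function on $\mathbb{D}$ with unimodular radial limits almost everywhere on $\mathbb{T}$; $\mathfrak{I}$ is the set of all inner functions. An outer function is a bounded analytic function $F$ on $\mathbb{D}$ that is a cyclic vector for the multiplication operator $M_z$ on $H^2$, i.e. the closed linear span of $\{z^kF(z): k\ge 0\}$ is $H^2$; $\mathfrak{F}$ is the set of all outer functions. An inner function $u$ is called normalized if $u^{(n_0)}(0)>0$, where $n_0$ is the smallest nonnegative integer with $u^{(n_0)}(0)\neq 0$. Every nonzero $f\in H^{\infty}$ has a unique factorization $f=uF$ with $u$ a normalized inner function and $F$ an outer function; put $Q_{inn}(f)=u$ and $Q_{out}(f)=F$. $\mathrm{Hol}(\overline{\mathbb{D}})$ is the set of all functions analytic in the closed unit disk (i.e. analytic on some open neighbourhood, depending on the function, of $\overline{\mathbb{D}}$), regarded as a subset of $H^{\infty}$. For nonzero $f$, $\mathrm{Mul}_0(f)=\inf\{k\ge 0: f^{(k)}(0)\neq 0\}$ is the multiplicity of the zero of $f$ at $0$, and $\mathrm{Hol}_n(\overline{\mathbb{D}})=\{f\in\mathrm{Hol}(\overline{\mathbb{D}}): \mathrm{Mul}_0(f)=n\}$. *)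

theory Defs
  imports "HOL-Complex_Analysis.Complex_Analysis"
begin

text \<open>
  A function on the open unit disc is represented by a total function on \<^typ>\<open>complex\<close> that is
  \<open>0\<close> off the disc, so that equality of representatives is equality of functions on the disc,
  the norms below induce genuine metrics, and factorizations are unique as HOL functions.
\<close>

definition Hol_disc :: "(complex \<Rightarrow> complex) set" where
  "Hol_disc = {f. f holomorphic_on ball 0 1 \<and> (\<forall>z. z \<notin> ball 0 1 \<longrightarrow> f z = 0)}"

definition Hinf :: "(complex \<Rightarrow> complex) set" where
  "Hinf = {f \<in> Hol_disc. bounded (f ` ball 0 1)}"

definition Hinf_norm :: "(complex \<Rightarrow> complex) \<Rightarrow> real" where
  "Hinf_norm f = (SUP z\<in>ball 0 1. norm (f z))"

definition mean2 :: "(complex \<Rightarrow> complex) \<Rightarrow> real \<Rightarrow> real" where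
  "mean2 f r = sqrt (1 / (2 * pi) * integral {0..2 * pi} (\<lambda>t. (norm (f (of_real r * cis t)))\<^sup>2))"

definition H2 :: "(complex \<Rightarrow> complex) set" where
  "H2 = {f \<in> Hol_disc. bdd_above (mean2 f ` {0..<1})}"

definition H2_norm :: "(complex \<Rightarrow> complex) \<Rightarrow> real" where
  "H2_norm f = (SUP r\<in>{0..<1}. mean2 f r)"

text \<open>
  The guards make the distances nonnegative everywhere, as the locale \<^locale>\<open>Metric_space\<close>
  requires; the supremum of an unbounded set of reals is unspecified.
\<close>

definition Hinf_dist :: "(complex \<Rightarrow> complex) \<Rightarrow> (complex \<Rightarrow> complex) \<Rightarrow> real" where
  "Hinf_dist f g = (if f \<in> Hinf \<and> g \<in> Hinf then Hinf_norm (\<lambda>z. f z - g z) else 0)"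

definition H2_dist :: "(complex \<Rightarrow> complex) \<Rightarrow> (complex \<Rightarrow> complex) \<Rightarrow> real" where
  "H2_dist f g = (if f \<in> H2 \<and> g \<in> H2 then H2_norm (\<lambda>z. f z - g z) else 0)"

definition Hinf_top :: "(complex \<Rightarrow> complex) set \<Rightarrow> (complex \<Rightarrow> complex) topology" where
  "Hinf_top A = Metric_space.mtopology A Hinf_dist"

definition H2_top :: "(complex \<Rightarrow> complex) set \<Rightarrow> (complex \<Rightarrow> complex) topology" where
  "H2_top A = Metric_space.mtopology A H2_dist"

definition inner_functions :: "(complex \<Rightarrow> complex) set" where
  "inner_functions = {u \<in> Hinf. AE t in lebesgue_on {0..2 * pi}.
     \<exists>l. norm l = 1 \<and> ((\<lambda>r. u (of_real r * cis t)) \<longlongrightarrow> l) (at_left 1)}"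

text \<open>The complex linear span of the functions \<open>z\<^sup>k F(z)\<close>, \<open>k \<ge> 0\<close>.\<close>

definition shift_span :: "(complex \<Rightarrow> complex) \<Rightarrow> (complex \<Rightarrow> complex) set" where
  "shift_span F = {\<lambda>z. \<Sum>k<m. c k * (z ^ k * F z) |(c :: nat \<Rightarrow> complex) m. True}"

definition outer_functions :: "(complex \<Rightarrow> complex) set" where
  "outer_functions = {F \<in> Hinf. H2_top H2 closure_of shift_span F = H2}"

text \<open>Since \<^term>\<open>Inf {} = (0::nat)\<close>, this is meaningful only for \<open>f\<close> that is nonzero on the disc.\<close>

definition Mul0 :: "(complex \<Rightarrow> complex) \<Rightarrow> nat" where
  "Mul0 f = Inf {k. (deriv ^^ k) f 0 \<noteq> 0}"

definition normalized :: "(complex \<Rightarrow> complex) \<Rightarrow> bool" where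
  "normalized u \<longleftrightarrow> (\<exists>x::real. x > 0 \<and> (deriv ^^ Mul0 u) u 0 = of_real x)"

definition is_inner_outer_factorization ::
    "(complex \<Rightarrow> complex) \<Rightarrow> (complex \<Rightarrow> complex) \<Rightarrow> (complex \<Rightarrow> complex) \<Rightarrow> bool" where
  "is_inner_outer_factorization f u F \<longleftrightarrow>
     u \<in> inner_functions \<and> normalized u \<and> F \<in> outer_functions \<and> f = (\<lambda>z. u z * F z)"

definition Q_inn :: "(complex \<Rightarrow> complex) \<Rightarrow> (complex \<Rightarrow> complex)" where
  "Q_inn f = (THE u. \<exists>F. is_inner_outer_factorization f u F)"

definition Q_out :: "(complex \<Rightarrow> complex) \<Rightarrow> (complex \<Rightarrow> complex)" where
  "Q_out f = (THE F. \<exists>u. is_inner_outer_factorization f u F)"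

definition Hol_closed_disc :: "(complex \<Rightarrow> complex) set" where
  "Hol_closed_disc = {f \<in> Hinf. \<exists>U g. open U \<and> cball 0 1 \<subseteq> U \<and> g holomorphic_on U \<and>
     (\<forall>z\<in>ball 0 1. f z = g z)}"

definition Hol_n :: "nat \<Rightarrow> (complex \<Rightarrow> complex) set" where
  "Hol_n n = {f \<in> Hol_closed_disc. f \<noteq> (\<lambda>z. 0) \<and> Mul0 f = n}"


subsection \<open>The two distances are metrics\<close>

lemma Hol_disc_diff: "f \<in> Hol_disc \<Longrightarrow> g \<in> Hol_disc \<Longrightarrow> (\<lambda>z. f z - g z) \<in> Hol_disc"
  by (auto simp: Hol_disc_def intro: holomorphic_on_diff)

lemma Hinf_bound: "f \<in> Hinf \<Longrightarrow> \<exists>B. \<forall>z. norm (f z) \<le> B"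
proof -
  assume f: "f \<in> Hinf"
  then obtain B where B: "\<And>z. z \<in> ball 0 1 \<Longrightarrow> norm (f z) \<le> B"
    unfolding Hinf_def bounded_iff by blast
  have "norm (f z) \<le> max B 0" for z
    using B[of z] f by (cases "z \<in> ball 0 1") (auto simp: Hinf_def Hol_disc_def)
  then show ?thesis by blast
qed

lemma Hinf_diff: "f \<in> Hinf \<Longrightarrow> g \<in> Hinf \<Longrightarrow> (\<lambda>z. f z - g z) \<in> Hinf"
  by (auto simp: Hinf_def Hol_disc_diff bounded_minus_comp)

lemma norm_le_Hinf_norm: "f \<in> Hinf \<Longrightarrow> norm (f z) \<le> Hinf_norm f"
proof -
  assume f: "f \<in> Hinf"
  obtain B where B: "\<And>z. norm (f z) \<le> B" using Hinf_bound[OF f] by blast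
  have bdd: "bdd_above ((\<lambda>z. norm (f z)) ` ball 0 1)" using B by (auto intro!: bdd_aboveI)
  have le: "norm (f z) \<le> Hinf_norm f" if "z \<in> ball 0 1" for z
    unfolding Hinf_norm_def using bdd that by (rule cSUP_upper2) auto
  show ?thesis
  proof (cases "z \<in> ball 0 1")
    case False
    then have "f z = 0" using f by (auto simp: Hinf_def Hol_disc_def)
    then show ?thesis using order_trans[OF norm_ge_zero le[of 0]] by simp
  qed (use le in auto)
qed

lemma Hinf_norm_le: "(\<And>z. norm (f z) \<le> B) \<Longrightarrow> Hinf_norm f \<le> B"
  unfolding Hinf_norm_def by (rule cSUP_least) auto

lemma Hinf_norm_minus: "Hinf_norm (\<lambda>z. f z - g z) = Hinf_norm (\<lambda>z. g z - f z)"
  unfolding Hinf_norm_def by (simp add: norm_minus_commute)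

lemma Metric_space_Hinf:
  assumes "A \<subseteq> Hinf"
  shows "Metric_space A Hinf_dist"
proof -
  have nonneg: "0 \<le> Hinf_norm f" if "f \<in> Hinf" for f
    using norm_le_Hinf_norm[OF that, of 0] norm_ge_zero order_trans by blast
  have "Metric_space Hinf Hinf_dist"
  proof
    fix f g h
    show "0 \<le> Hinf_dist f g"
      by (simp add: Hinf_dist_def nonneg Hinf_diff)
    show "Hinf_dist f g = Hinf_dist g f"
      by (simp add: Hinf_dist_def Hinf_norm_minus[of f g])
    assume f: "f \<in> Hinf" and g: "g \<in> Hinf"
    show "Hinf_dist f g = 0 \<longleftrightarrow> f = g"
    proof
      assume "Hinf_dist f g = 0"
      then have "norm (f z - g z) \<le> 0" for z
        using norm_le_Hinf_norm[OF Hinf_diff[OF f g], of z] f g by (simp add: Hinf_dist_def)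
      then show "f = g" by auto
    qed (auto simp: Hinf_dist_def Hinf_norm_def)
    assume h: "h \<in> Hinf"
    have "Hinf_norm (\<lambda>z. f z - h z) \<le> Hinf_norm (\<lambda>z. f z - g z) + Hinf_norm (\<lambda>z. g z - h z)"
    proof (rule Hinf_norm_le)
      fix z
      have "norm (f z - h z) \<le> norm (f z - g z) + norm (g z - h z)"
        using norm_triangle_ineq[of "f z - g z" "g z - h z"] by simp
      then show "norm (f z - h z) \<le> Hinf_norm (\<lambda>z. f z - g z) + Hinf_norm (\<lambda>z. g z - h z)"
        using norm_le_Hinf_norm[OF Hinf_diff[OF f g], of z]
          norm_le_Hinf_norm[OF Hinf_diff[OF g h], of z] by linarith
    qed
    then show "Hinf_dist f h \<le> Hinf_dist f g + Hinf_dist g h"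
      using f g h by (simp add: Hinf_dist_def)
  qed
  then show ?thesis by (rule Metric_space.subspace) fact
qed

lemma continuous_on_circle:
  assumes f: "f \<in> Hol_disc" and r: "r \<in> {0..<1}"
  shows "continuous_on S (\<lambda>t. f (of_real r * cis t))"
proof -
  have c: "continuous_on (ball 0 1) f"
    using f holomorphic_on_imp_continuous_on by (auto simp: Hol_disc_def)
  show ?thesis
    by (rule continuous_on_compose2[OF c]) (use r in \<open>auto intro!: continuous_intros simp: norm_mult\<close>)
qed

lemma integrable_circle:
  assumes "f \<in> Hol_disc" "r \<in> {0..<1}"
  shows "(\<lambda>t. (norm (f (of_real r * cis t)))\<^sup>2) integrable_on {0..2 * pi}"
  by (intro integrable_continuous_interval continuous_intros continuous_on_circle assms)

lemma mean2_nonneg: "0 \<le> mean2 f r"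
proof -
  have "0 \<le> integral {0..2 * pi} (\<lambda>t. (norm (f (of_real r * cis t)))\<^sup>2)"
    by (cases "(\<lambda>t. (norm (f (of_real r * cis t)))\<^sup>2) integrable_on {0..2 * pi}")
       (simp_all add: not_integrable_integral Henstock_Kurzweil_Integration.integral_nonneg)
  then show ?thesis by (simp add: mean2_def)
qed

lemma mean2_square:
  assumes "f \<in> Hol_disc" "r \<in> {0..<1}"
  shows "(mean2 f r)\<^sup>2 = 1 / (2 * pi) * integral {0..2 * pi} (\<lambda>t. (norm (f (of_real r * cis t)))\<^sup>2)"
proof -
  have "0 \<le> integral {0..2 * pi} (\<lambda>t. (norm (f (of_real r * cis t)))\<^sup>2)"
    by (rule Henstock_Kurzweil_Integration.integral_nonneg[OF integrable_circle[OF assms]]) auto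
  then show ?thesis by (simp add: mean2_def)
qed

lemma mean2_le_bound:
  assumes f: "f \<in> Hol_disc" and r: "r \<in> {0..<1}" and B: "\<And>z. norm (f z) \<le> B"
  shows "mean2 f r \<le> B"
proof -
  have B0: "0 \<le> B" using order_trans[OF norm_ge_zero B] .
  have "integral {0..2 * pi} (\<lambda>t. (norm (f (of_real r * cis t)))\<^sup>2) \<le> integral {0..2 * pi} (\<lambda>t. B\<^sup>2)"
    by (rule integral_le[OF integrable_circle[OF f r]]) (auto intro: power_mono B)
  then have "(mean2 f r)\<^sup>2 \<le> 1 / (2 * pi) * (2 * pi * B\<^sup>2)"
    unfolding mean2_square[OF f r] by (intro mult_left_mono) auto
  then have "(mean2 f r)\<^sup>2 \<le> B\<^sup>2" by simp
  then show ?thesis using B0 power2_le_imp_le by blast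
qed

lemma Hinf_subset_H2: "Hinf \<subseteq> H2"
proof
  fix f assume f: "f \<in> Hinf"
  obtain B where "\<And>z. norm (f z) \<le> B" using Hinf_bound[OF f] by blast
  then have "mean2 f r \<le> B" if "r \<in> {0..<1}" for r
    using f that by (intro mean2_le_bound) (auto simp: Hinf_def)
  then show "f \<in> H2" using f by (auto simp: H2_def Hinf_def intro!: bdd_aboveI[of _ B])
qed

lemma weighted_square_add:
  fixes x y a b s t :: real
  assumes a: "0 < a" and b: "0 < b" and "0 \<le> s" "s \<le> x + y" "0 \<le> x" "0 \<le> y"
  shows "s\<^sup>2 \<le> (1 + b / a) * x\<^sup>2 + (1 + a / b) * y\<^sup>2"
proof -
  have "s\<^sup>2 \<le> (x + y)\<^sup>2" using assms by (intro power_mono) auto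
  moreover have "(1 + b / a) * x\<^sup>2 + (1 + a / b) * y\<^sup>2 - (x + y)\<^sup>2 = (b * x - a * y)\<^sup>2 / (a * b)"
    using a b by (simp add: field_simps power2_eq_square)
  moreover have "0 \<le> (b * x - a * y)\<^sup>2 / (a * b)" using a b by simp
  ultimately show ?thesis by linarith
qed

lemma mean2_triangle:
  assumes f: "f \<in> Hol_disc" and g: "g \<in> Hol_disc" and h: "h \<in> Hol_disc" and r: "r \<in> {0..<1}"
  shows "mean2 (\<lambda>z. f z - h z) r \<le> mean2 (\<lambda>z. f z - g z) r + mean2 (\<lambda>z. g z - h z) r"
    (is "?L \<le> ?A + ?B")
proof (rule field_le_epsilon)
  fix e :: real assume e: "0 < e"
  define a where "a = ?A + e / 2"
  define b where "b = ?B + e / 2"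
  have a: "0 < a" "?A \<le> a" and b: "0 < b" "?B \<le> b"
    using e mean2_nonneg[of "\<lambda>z. f z - g z" r] mean2_nonneg[of "\<lambda>z. g z - h z" r]
    by (auto simp: a_def b_def)
  define I where "I k = integral {0..2 * pi} (\<lambda>t. (norm (k (of_real r * cis t)))\<^sup>2)"
    for k :: "complex \<Rightarrow> complex"
  note fg = Hol_disc_diff[OF f g] and gh = Hol_disc_diff[OF g h] and fh = Hol_disc_diff[OF f h]
  have i1: "(\<lambda>t. (1 + b / a) * (norm (f (of_real r * cis t) - g (of_real r * cis t)))\<^sup>2)
      integrable_on {0..2 * pi}"
    using integrable_on_cmult_left[OF integrable_circle[OF fg r], of "1 + b / a"] by simp
  have i2: "(\<lambda>t. (1 + a / b) * (norm (g (of_real r * cis t) - h (of_real r * cis t)))\<^sup>2)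
      integrable_on {0..2 * pi}"
    using integrable_on_cmult_left[OF integrable_circle[OF gh r], of "1 + a / b"] by simp
  have "I (\<lambda>z. f z - h z) \<le> integral {0..2 * pi} (\<lambda>t.
      (1 + b / a) * (norm (f (of_real r * cis t) - g (of_real r * cis t)))\<^sup>2 +
      (1 + a / b) * (norm (g (of_real r * cis t) - h (of_real r * cis t)))\<^sup>2)"
    unfolding I_def
  proof (rule integral_le[OF integrable_circle[OF fh r] integrable_add[OF i1 i2]])
    fix t
    show "(norm (f (of_real r * cis t) - h (of_real r * cis t)))\<^sup>2 \<le>
      (1 + b / a) * (norm (f (of_real r * cis t) - g (of_real r * cis t)))\<^sup>2 +
      (1 + a / b) * (norm (g (of_real r * cis t) - h (of_real r * cis t)))\<^sup>2"
      using norm_triangle_ineq[of "f (of_real r * cis t) - g (of_real r * cis t)"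
          "g (of_real r * cis t) - h (of_real r * cis t)"]
      by (intro weighted_square_add[OF a(1) b(1)]) simp_all
  qed
  also have "\<dots> = (1 + b / a) * I (\<lambda>z. f z - g z) + (1 + a / b) * I (\<lambda>z. g z - h z)"
    unfolding I_def by (subst integral_add[OF i1 i2]) simp
  finally have le: "I (\<lambda>z. f z - h z) \<le> (1 + b / a) * I (\<lambda>z. f z - g z) + (1 + a / b) * I (\<lambda>z. g z - h z)" .
  have "?L\<^sup>2 \<le> 1 / (2 * pi) * ((1 + b / a) * I (\<lambda>z. f z - g z) + (1 + a / b) * I (\<lambda>z. g z - h z))"
    unfolding mean2_square[OF fh r] using le[unfolded I_def] unfolding I_def
    by (intro mult_left_mono) auto
  also have "\<dots> = (1 + b / a) * ?A\<^sup>2 + (1 + a / b) * ?B\<^sup>2"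
    unfolding mean2_square[OF fg r] mean2_square[OF gh r] I_def by (simp add: algebra_simps add_divide_distrib)
  also have "\<dots> \<le> (1 + b / a) * a\<^sup>2 + (1 + a / b) * b\<^sup>2"
    using a b mean2_nonneg by (intro add_mono mult_left_mono power_mono) auto
  also have "\<dots> = (a + b)\<^sup>2" using a b by (simp add: field_simps power2_eq_square)
  finally have "?L\<^sup>2 \<le> (a + b)\<^sup>2" .
  then have "?L \<le> a + b" by (rule power2_le_imp_le) (use a(1) b(1) in linarith)
  then show "?L \<le> ?A + ?B + e" by (simp add: a_def b_def)
qed

lemma mean2_minus: "mean2 (\<lambda>z. f z - g z) = mean2 (\<lambda>z. g z - f z)"
  unfolding mean2_def by (simp add: norm_minus_commute)

lemma mean2_zero [simp]: "mean2 (\<lambda>z. 0) r = 0"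
  by (simp add: mean2_def)

lemma zero_Hol_disc: "(\<lambda>z. 0) \<in> Hol_disc"
  by (simp add: Hol_disc_def)

lemma mean2_le_H2_norm: "f \<in> H2 \<Longrightarrow> r \<in> {0..<1} \<Longrightarrow> mean2 f r \<le> H2_norm f"
  unfolding H2_norm_def H2_def by (rule cSUP_upper) auto

lemma H2_norm_le: "(\<And>r. r \<in> {0..<1} \<Longrightarrow> mean2 f r \<le> B) \<Longrightarrow> H2_norm f \<le> B"
  unfolding H2_norm_def by (rule cSUP_least) auto

lemma H2_norm_nonneg: "f \<in> H2 \<Longrightarrow> 0 \<le> H2_norm f"
  using mean2_le_H2_norm[of f 0] mean2_nonneg[of f 0] by simp

lemma H2_diff:
  assumes f: "f \<in> H2" and g: "g \<in> H2"
  shows "(\<lambda>z. f z - g z) \<in> H2"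
proof -
  have hol: "f \<in> Hol_disc" "g \<in> Hol_disc" using f g by (auto simp: H2_def)
  have "mean2 (\<lambda>z. f z - g z) r \<le> H2_norm f + H2_norm g" if r: "r \<in> {0..<1}" for r
    using mean2_triangle[OF hol(1) zero_Hol_disc hol(2) r] mean2_minus[of "\<lambda>z. 0" g]
      mean2_le_H2_norm[OF f r] mean2_le_H2_norm[OF g r] by simp
  then show ?thesis
    by (auto simp: H2_def Hol_disc_diff hol intro!: bdd_aboveI[of _ "H2_norm f + H2_norm g"])
qed

lemma mean2_eq_0:
  assumes f: "f \<in> Hol_disc" and r: "r \<in> {0..<1}" and 0: "mean2 f r = 0" and t: "t \<in> {0..2 * pi}"
  shows "f (of_real r * cis t) = 0"
proof -
  have "integral {0..2 * pi} (\<lambda>t. (norm (f (of_real r * cis t)))\<^sup>2) = 0"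
    using mean2_square[OF f r] 0 by simp
  moreover have "continuous_on {0..2 * pi} (\<lambda>t. (norm (f (of_real r * cis t)))\<^sup>2)"
    by (intro continuous_intros continuous_on_circle f r)
  ultimately show ?thesis
    using integral_eq_0_iff[of 0 "2 * pi" "\<lambda>t. (norm (f (of_real r * cis t)))\<^sup>2"] t by auto
qed

lemma H2_norm_eq_0:
  assumes f: "f \<in> H2" and 0: "H2_norm f = 0"
  shows "f z = 0"
proof (cases "z \<in> ball 0 1")
  case True
  have hol: "f \<in> Hol_disc" using f by (simp add: H2_def)
  have r: "norm z \<in> {0..<1}" using True by simp
  have "mean2 f (norm z) = 0"
    using mean2_le_H2_norm[OF f r] mean2_nonneg[of f "norm z"] 0 by simp
  moreover obtain t where t: "t \<in> {0..2 * pi}" "z = of_real (norm z) * cis t"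
  proof (rule that[of "Arg2pi z"])
    show "z = of_real (norm z) * cis (Arg2pi z)"
      using Arg2pi[of z] unfolding is_Arg_def cis_conv_exp by blast
  qed (use Arg2pi[of z] in auto)
  ultimately show ?thesis using mean2_eq_0[OF hol r _ t(1)] t(2) by simp
next
  case False
  then show ?thesis using f by (simp add: H2_def Hol_disc_def)
qed

lemma Metric_space_H2:
  assumes "A \<subseteq> H2"
  shows "Metric_space A H2_dist"
proof -
  have "Metric_space H2 H2_dist"
  proof
    fix f g h
    show "0 \<le> H2_dist f g"
      by (simp add: H2_dist_def H2_norm_nonneg H2_diff)
    show "H2_dist f g = H2_dist g f"
      by (simp add: H2_dist_def H2_norm_def mean2_minus[of f g])
    assume f: "f \<in> H2" and g: "g \<in> H2"
    show "H2_dist f g = 0 \<longleftrightarrow> f = g"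
    proof
      assume "H2_dist f g = 0"
      then have "f z - g z = 0" for z
        using f g by (intro H2_norm_eq_0[OF H2_diff[OF f g]]) (simp add: H2_dist_def)
      then show "f = g" by auto
    qed (auto simp: H2_dist_def H2_norm_def)
    assume h: "h \<in> H2"
    have hol: "f \<in> Hol_disc" "g \<in> Hol_disc" "h \<in> Hol_disc" using f g h by (auto simp: H2_def)
    have "H2_norm (\<lambda>z. f z - h z) \<le> H2_norm (\<lambda>z. f z - g z) + H2_norm (\<lambda>z. g z - h z)"
    proof (rule H2_norm_le)
      fix r :: real assume r: "r \<in> {0..<1}"
      show "mean2 (\<lambda>z. f z - h z) r \<le> H2_norm (\<lambda>z. f z - g z) + H2_norm (\<lambda>z. g z - h z)"
        using mean2_triangle[OF hol r] mean2_le_H2_norm[OF H2_diff[OF f g] r]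
          mean2_le_H2_norm[OF H2_diff[OF g h] r] by linarith
    qed
    then show "H2_dist f h \<le> H2_dist f g + H2_dist g h"
      using f g h by (simp add: H2_dist_def)
  qed
  then show ?thesis by (rule Metric_space.subspace) fact
qed

lemma topspace_Hinf_top: "A \<subseteq> Hinf \<Longrightarrow> topspace (Hinf_top A) = A"
  unfolding Hinf_top_def by (simp add: Metric_space.topspace_mtopology Metric_space_Hinf)

lemma topspace_H2_top: "A \<subseteq> H2 \<Longrightarrow> topspace (H2_top A) = A"
  unfolding H2_top_def by (simp add: Metric_space.topspace_mtopology Metric_space_H2)

lemma subsets_of_Hinf:
  "inner_functions \<subseteq> Hinf" "outer_functions \<subseteq> Hinf" "Hol_n n \<subseteq> Hinf"
  by (auto simp: inner_functions_def outer_functions_def Hol_n_def Hol_closed_disc_def)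

end

theory Submission
  imports Defs
begin

text \<open>
  A function \<open>f\<close> that is analytic on the closed disc has finitely many zeros there, and so
  \<open>f = B F\<close> with a finite Blaschke product \<open>B\<close> over the zeros in the open disc and an outer function \<open>F\<close>
  that is continuous up to the circle. The proof works with this concrete factorization.

  An outer function \<open>F\<close> is used through a single property: some polynomial multiple \<open>p F\<close> is as close
  to \<open>1\<close> in \<open>H\<^sup>2\<close> as desired. It is combined with the fact that multiplication by an inner function \<open>u\<close>
  preserves the \<open>H\<^sup>2\<close> norm: if \<open>u g\<close> is close to \<open>1\<close> in \<open>H\<^sup>2\<close>, then \<open>\<bar>u(0)\<bar>\<close> is close to \<open>1\<close>
  (\<open>inner_near_one_at_0\<close>). The exact version of this statement says that an outer function has only
  constant inner factors, which yields the uniqueness of the factorization and thus the values of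
  the two maps (\<open>Q_values\<close>). The approximate version yields the continuity of the outer part
  (\<open>outer_part_converges\<close>). Let \<open>f\<^sub>k = B\<^sub>k F\<^sub>k\<close> tend uniformly to \<open>f = B F\<close>. The zeros of \<open>B\<close> are limits of
  zeros of \<open>B\<^sub>k\<close>, by Hurwitz's theorem, and can be divided out one after the other; those at \<open>0\<close>
  occur with the same multiplicity everywhere. What remains is a sequence \<open>c\<^sub>k F\<^sub>k\<close> that tends to \<open>F\<close>,
  with Blaschke products \<open>c\<^sub>k\<close>. Now \<open>c\<^sub>k(0)\<close> tends to \<open>1\<close>, hence the sum of the distances of the zeros of
  \<open>c\<^sub>k\<close> to the circle tends to \<open>0\<close>, and \<open>c\<^sub>k\<close> is close to \<open>1\<close> at those points of the circle that are far
  from these zeros. The remaining points are near zeros of \<open>c\<^sub>k\<close>, so both \<open>F\<close> and \<open>F\<^sub>k\<close> are small there.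

  The inner parts then converge in \<open>H\<^sup>2\<close>, since \<open>F (B - B\<^sub>k)\<close> tends uniformly to \<open>0\<close> and \<open>F\<close> is
  invertible up to a small error in \<open>H\<^sup>2\<close> (\<open>inner_part_converges_H2\<close>). They do not converge uniformly
  in general: for \<open>z\<^sup>n (z - a)\<close> with \<open>a\<close> increasing to \<open>1\<close> a Blaschke factor is lost in the limit
  (\<open>Q_inn_not_continuous\<close>).
\<close>

section \<open>Quadratic means of holomorphic functions on the disc\<close>

definition on_disc :: "(complex \<Rightarrow> complex) \<Rightarrow> complex \<Rightarrow> complex" where
  "on_disc f = (\<lambda>z. if z \<in> ball 0 1 then f z else 0)"

lemma on_disc_in: "norm z < 1 \<Longrightarrow> on_disc f z = f z"
  by (simp add: on_disc_def)

lemma on_disc_Hol_disc: "f holomorphic_on ball 0 1 \<Longrightarrow> on_disc f \<in> Hol_disc"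
  by (auto simp: Hol_disc_def on_disc_def elim!: holomorphic_transform)

lemma on_disc_Hinf:
  assumes "f holomorphic_on ball 0 1" "\<And>z. norm z < 1 \<Longrightarrow> norm (f z) \<le> B"
  shows "on_disc f \<in> Hinf"
  using on_disc_Hol_disc[OF assms(1)] assms(2)
  by (auto simp: Hinf_def bounded_iff on_disc_def intro!: exI[of _ B])

lemma mean2_cong:
  assumes "\<And>z. norm z < 1 \<Longrightarrow> f z = g z" "r \<in> {0..<1}"
  shows "mean2 f r = mean2 g r"
  using assms by (simp add: mean2_def norm_mult)

lemma mean2_square_hol:
  assumes "f holomorphic_on ball 0 1" "r \<in> {0..<1}"
  shows "(mean2 f r)\<^sup>2 = 1 / (2 * pi) * integral {0..2 * pi} (\<lambda>t. (norm (f (of_real r * cis t)))\<^sup>2)"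
proof -
  have "(mean2 f r)\<^sup>2 = (mean2 (on_disc f) r)\<^sup>2"
    using assms by (subst mean2_cong[of _ "on_disc f"]) (auto simp: on_disc_in)
  also have "\<dots> = 1 / (2 * pi) * integral {0..2 * pi} (\<lambda>t. (norm (on_disc f (of_real r * cis t)))\<^sup>2)"
    by (rule mean2_square[OF on_disc_Hol_disc assms(2)]) fact
  finally show ?thesis using assms by (simp add: on_disc_in norm_mult)
qed

lemma mean2_diff_le:
  assumes "f holomorphic_on ball 0 1" "g holomorphic_on ball 0 1" "h holomorphic_on ball 0 1"
    "r \<in> {0..<1}"
  shows "mean2 (\<lambda>z. f z - h z) r \<le> mean2 (\<lambda>z. f z - g z) r + mean2 (\<lambda>z. g z - h z) r"
proof -
  have "mean2 (\<lambda>z. a z - b z) r = mean2 (\<lambda>z. on_disc a z - on_disc b z) r" for a b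
    using assms(4) by (intro mean2_cong) (auto simp: on_disc_in)
  then show ?thesis using mean2_triangle[of "on_disc f" "on_disc g" "on_disc h" r] assms
    by (simp add: on_disc_Hol_disc)
qed

lemma mean2_add_le:
  assumes "f holomorphic_on ball 0 1" "g holomorphic_on ball 0 1" "r \<in> {0..<1}"
  shows "mean2 (\<lambda>z. f z + g z) r \<le> mean2 f r + mean2 g r"
  using mean2_diff_le[of f "\<lambda>z. 0" "\<lambda>z. - g z" r] assms
  by (simp add: holomorphic_on_minus)

lemma mean2_mult_le:
  assumes "f holomorphic_on ball 0 1" "g holomorphic_on ball 0 1" "r \<in> {0..<1}"
    and B: "\<And>z. norm z < 1 \<Longrightarrow> norm (g z) \<le> B"
  shows "mean2 (\<lambda>z. g z * f z) r \<le> B * mean2 f r"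
proof -
  have B0: "0 \<le> B" using B[of 0] norm_ge_zero order_trans by (metis norm_zero zero_less_one)
  have gf: "(\<lambda>z. g z * f z) holomorphic_on ball 0 1" using assms by (intro holomorphic_intros)
  have int: "(\<lambda>t. (norm (h (of_real r * cis t)))\<^sup>2) integrable_on {0..2 * pi}"
    if "h holomorphic_on ball 0 1" for h
    using integrable_circle[OF on_disc_Hol_disc[OF that] assms(3)] assms(3)
    by (simp add: on_disc_in norm_mult)
  have "integral {0..2 * pi} (\<lambda>t. (norm (g (of_real r * cis t) * f (of_real r * cis t)))\<^sup>2)
     \<le> integral {0..2 * pi} (\<lambda>t. B\<^sup>2 * (norm (f (of_real r * cis t)))\<^sup>2)"
  proof (rule integral_le[OF int[OF gf]])
    show "(\<lambda>t. B\<^sup>2 * (norm (f (of_real r * cis t)))\<^sup>2) integrable_on {0..2 * pi}"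
      using integrable_on_cmult_left[OF int[OF assms(1)], of "B\<^sup>2"] by simp
    show "(norm (g (of_real r * cis t) * f (of_real r * cis t)))\<^sup>2
       \<le> B\<^sup>2 * (norm (f (of_real r * cis t)))\<^sup>2" for t
      using assms(3) unfolding norm_mult power_mult_distrib
      by (intro mult_right_mono power_mono B) (auto simp: norm_mult)
  qed
  then have "(mean2 (\<lambda>z. g z * f z) r)\<^sup>2 \<le> (B * mean2 f r)\<^sup>2"
    unfolding power_mult_distrib mean2_square_hol[OF gf assms(3)] mean2_square_hol[OF assms(1,3)]
    by (simp add: divide_right_mono)
  then show ?thesis by (rule power2_le_imp_le) (simp add: mean2_nonneg B0)
qed

lemma mean2_one: "mean2 (\<lambda>z. 1) r = 1"
  by (simp add: mean2_def)

lemma mean2_le_sup: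
  assumes "f holomorphic_on ball 0 1" "r \<in> {0..<1}" "\<And>z. norm z < 1 \<Longrightarrow> norm (f z) \<le> B"
  shows "mean2 f r \<le> B"
  using mean2_mult_le[of "\<lambda>z. 1" f r B] assms by (simp add: mean2_one)

lemma integral_cis_int:
  fixes m :: int
  shows "((\<lambda>t. cis (of_int m * t)) has_integral (if m = 0 then of_real (2 * pi) else 0)) {0..2*pi}"
proof (cases "m = 0")
  case True
  have "measure lborel {0..2*pi} = 2*pi" by (subst content_real) auto
  then have "((\<lambda>t. 1) has_integral complex_of_real (2 * pi)) {0..2*pi}"
    using has_integral_const_real[of "1::complex" 0 "2*pi"] by (simp only: scaleR_conv_of_real mult_1_right)
  moreover have "(\<lambda>t. cis (of_int m * t)) = (\<lambda>t. 1)" using True by auto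
  ultimately show ?thesis using True by (simp only: if_True refl)
next
  case False
  have "((\<lambda>t. cis (of_int m * t)) has_integral
      (cis (of_int m * (2*pi)) / (\<i> * of_int m) - cis (of_int m * 0) / (\<i> * of_int m))) {0..2*pi}"
  proof (rule fundamental_theorem_of_calculus)
    fix t :: real
    have "((\<lambda>z. exp (\<i> * of_int m * z) / (\<i> * of_int m)) has_field_derivative
        exp (\<i> * of_int m * of_real t)) (at (of_real t))"
      by (rule derivative_eq_intros refl | simp add: False)+
    from has_vector_derivative_real_field[OF this]
    show "((\<lambda>t. cis (of_int m * t) / (\<i> * of_int m)) has_vector_derivative cis (of_int m * t))
        (at t within {0..2*pi})" by (simp add: cis_conv_exp mult.assoc)
  qed simp
  moreover have "cis (of_int m * (2*pi)) = 1"
    using cis_multiple_2pi[of "of_int m"] by (metis Ints_of_int mult.commute)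
  ultimately show ?thesis using False by simp
qed

text \<open>
  Parseval's identity for polynomials: the powers are orthogonal on every circle about \<open>0\<close>.
\<close>

lemma mean2_sum_powers:
  fixes c :: "nat \<Rightarrow> complex"
  assumes A: "finite A" and r: "r \<in> {0..<1}"
  shows "(mean2 (\<lambda>z. \<Sum>k\<in>A. c k * z ^ k) r)\<^sup>2 = (\<Sum>k\<in>A. (norm (c k))\<^sup>2 * r ^ (2 * k))"
proof -
  let ?f = "\<lambda>z. \<Sum>k\<in>A. c k * z ^ k"
  define d where "d k = c k * of_real r ^ k" for k
  have eq: "complex_of_real ((norm (?f (of_real r * cis t)))\<^sup>2)
     = (\<Sum>j\<in>A. \<Sum>k\<in>A. d j * cnj (d k) * cis (of_int (int j - int k) * t))" for t
  proof -
    have "?f (of_real r * cis t) = (\<Sum>k\<in>A. d k * cis (of_nat k * t))"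
      by (simp add: d_def power_mult_distrib Complex.DeMoivre mult.assoc)
    then have "complex_of_real ((norm (?f (of_real r * cis t)))\<^sup>2) =
       (\<Sum>j\<in>A. d j * cis (of_nat j * t)) * cnj (\<Sum>k\<in>A. d k * cis (of_nat k * t))"
      by (simp only: complex_norm_square)
    also have "\<dots> = (\<Sum>j\<in>A. \<Sum>k\<in>A. (d j * cis (of_nat j * t)) * cnj (d k * cis (of_nat k * t)))"
      by (simp add: sum_product)
    also have "\<dots> = (\<Sum>j\<in>A. \<Sum>k\<in>A. d j * cnj (d k) * cis (of_int (int j - int k) * t))"
      by (intro sum.cong refl) (simp add: cis_cnj cis_mult algebra_simps)
    finally show ?thesis .
  qed
  have "((\<lambda>t. complex_of_real ((norm (?f (of_real r * cis t)))\<^sup>2)) has_integral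
      (\<Sum>j\<in>A. \<Sum>k\<in>A. d j * cnj (d k) * (if int j - int k = 0 then of_real (2 * pi) else 0))) {0..2*pi}"
    unfolding eq using A by (intro has_integral_sum has_integral_mult_right integral_cis_int)
  also have "(\<Sum>j\<in>A. \<Sum>k\<in>A. d j * cnj (d k) * (if int j - int k = 0 then of_real (2 * pi) else 0))
     = (\<Sum>j\<in>A. \<Sum>k\<in>A. if j = k then d j * cnj (d k) * of_real (2 * pi) else 0)"
    by (intro sum.cong refl) auto
  also have "\<dots> = of_real (2 * pi * (\<Sum>j\<in>A. (norm (d j))\<^sup>2))"
    using A by (simp add: sum_distrib_left complex_norm_square mult.commute mult.left_commute del: of_real_power)
  finally have "((\<lambda>t. complex_of_real ((norm (?f (of_real r * cis t)))\<^sup>2)) has_integral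
     of_real (2 * pi * (\<Sum>j\<in>A. (norm (d j))\<^sup>2))) {0..2*pi}" .
  from has_integral_Re[OF this]
  have "integral {0..2*pi} (\<lambda>t. (norm (?f (of_real r * cis t)))\<^sup>2) = 2 * pi * (\<Sum>j\<in>A. (norm (d j))\<^sup>2)"
    by (intro integral_unique) simp
  moreover have "?f holomorphic_on ball 0 1" by (intro holomorphic_intros)
  ultimately have "(mean2 ?f r)\<^sup>2 = (\<Sum>j\<in>A. (norm (d j))\<^sup>2)"
    using mean2_square_hol[OF _ r, of ?f] by simp
  also have "\<dots> = (\<Sum>k\<in>A. (norm (c k))\<^sup>2 * r ^ (2 * k))"
    using r by (simp add: d_def norm_mult norm_power power_mult_distrib power_mult[symmetric] mult.commute)
  finally show ?thesis .
qed

section \<open>Taylor coefficients and density of the polynomials in \<open>H\<^sup>2\<close>\<close>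

definition taylor_coeff :: "(complex \<Rightarrow> complex) \<Rightarrow> nat \<Rightarrow> complex" where
  "taylor_coeff f k = (deriv ^^ k) f 0 / fact k"

lemma taylor_sums:
  assumes "f holomorphic_on ball 0 1" "norm z < 1"
  shows "(\<lambda>k. taylor_coeff f k * z ^ k) sums f z"
  using holomorphic_power_series[OF assms(1), of z] assms(2) by (simp add: taylor_coeff_def)

lemma taylor_coeff_0 [simp]: "taylor_coeff f 0 = f 0"
  by (simp add: taylor_coeff_def)

text \<open>
  On a circle of radius \<open>r < 1\<close> the Taylor series converges uniformly, with remainder bounded by the tail
  of \<open>\<Sum>\<bar>a\<^sub>k\<bar> r\<^sup>k\<close>.
\<close>

lemma mean2_taylor_tendsto:
  assumes f: "f holomorphic_on ball 0 1" and r: "r \<in> {0..<1}"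
  shows "(\<lambda>N. mean2 (\<lambda>z. f z - (\<Sum>k<N. taylor_coeff f k * z ^ k)) r) \<longlonglongrightarrow> 0"
proof -
  define a where "a = taylor_coeff f"
  have sums: "(\<lambda>k. a k * z ^ k) sums f z" if "norm z < 1" for z
    using taylor_sums[OF f that] by (simp add: a_def)
  obtain \<rho> where \<rho>: "r < \<rho>" "\<rho> < 1" using dense r by auto
  have "summable (\<lambda>k. norm (a k * of_real r ^ k))"
    by (rule powser_insidea[of _ "of_real \<rho>"]) (use sums[of "of_real \<rho>"] \<rho> r in \<open>auto intro: sums_summable\<close>)
  then have sm: "summable (\<lambda>k. norm (a k) * r ^ k)" using r by (simp add: norm_mult norm_power)
  define R where "R N = (\<Sum>k. norm (a (k + N)) * r ^ (k + N))" for N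
  have R0: "R \<longlonglongrightarrow> 0" unfolding R_def by (rule suminf_exist_split2[OF sm])
  have bound: "mean2 (\<lambda>z. f z - (\<Sum>k<N. a k * z ^ k)) r \<le> R N" for N
  proof -
    have le: "norm (f z - (\<Sum>k<N. a k * z ^ k)) \<le> R N" if z: "norm z = r" for z
    proof -
      have z1: "norm z < 1" using z r by simp
      have "(\<lambda>k. a (k + N) * z ^ (k + N)) sums (f z - (\<Sum>k<N. a k * z ^ k))"
        using sums_iff_shift[of "\<lambda>k. a k * z ^ k" N] sums[OF z1] by simp
      moreover have "summable (\<lambda>k. norm (a (k + N) * z ^ (k + N)))"
        using summable_ignore_initial_segment[OF sm, of N] z by (simp add: norm_mult norm_power)
      ultimately have "norm (f z - (\<Sum>k<N. a k * z ^ k)) \<le> (\<Sum>k. norm (a (k + N) * z ^ (k + N)))"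
        using summable_norm sums_unique by metis
      then show ?thesis using z by (simp add: R_def norm_mult norm_power)
    qed
    define h where "h z = f z - (\<Sum>k<N. a k * z ^ k)" for z
    have hh: "h holomorphic_on ball 0 1" unfolding h_def using f by (intro holomorphic_intros)
    have "integral {0..2 * pi} (\<lambda>t. (norm (h (of_real r * cis t)))\<^sup>2) \<le> integral {0..2*pi} (\<lambda>t. (R N)\<^sup>2)"
    proof (rule integral_le)
      show "(\<lambda>t. (norm (h (of_real r * cis t)))\<^sup>2) integrable_on {0..2 * pi}"
        using integrable_circle[OF on_disc_Hol_disc[OF hh] r] r by (simp add: on_disc_in norm_mult)
      show "(norm (h (of_real r * cis t)))\<^sup>2 \<le> (R N)\<^sup>2" for t
        using le[of "of_real r * cis t"] r by (intro power_mono) (auto simp: h_def norm_mult)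
    qed auto
    then have "(mean2 h r)\<^sup>2 \<le> (R N)\<^sup>2"
      unfolding mean2_square_hol[OF hh r] by (simp add: field_simps)
    moreover have "R N \<ge> 0" using le[of "of_real r"] r norm_ge_zero order_trans by (metis norm_of_real abs_of_nonneg atLeastLessThan_iff)
    ultimately have "mean2 h r \<le> R N" using power2_le_imp_le by blast
    then show ?thesis unfolding h_def .
  qed
  show ?thesis
    by (rule tendsto_sandwich[OF _ _ tendsto_const R0])
       (use bound in \<open>auto simp: mean2_nonneg a_def intro!: always_eventually\<close>)
qed

text \<open>
  Bessel's inequality. The partial sums satisfy it with equality by orthogonality, and their means
  converge to the mean of \<open>f\<close>.
\<close>

lemma sum_taylor_le_mean2:
  assumes f: "f holomorphic_on ball 0 1" and r: "r \<in> {0..<1}"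
  shows "(\<Sum>k<N. (norm (taylor_coeff f k))\<^sup>2 * r ^ (2 * k)) \<le> (mean2 f r)\<^sup>2"
proof -
  let ?a = "taylor_coeff f"
  let ?s = "\<lambda>M z. \<Sum>k<M. ?a k * z ^ k"
  let ?S = "\<lambda>N. \<Sum>k<N. (norm (?a k))\<^sup>2 * r ^ (2 * k)"
  have S0: "0 \<le> ?S N" by (intro sum_nonneg) (use r in auto)
  have "sqrt (?S N) \<le> mean2 f r + mean2 (\<lambda>z. f z - ?s M z) r" if M: "N \<le> M" for M
  proof -
    have "?S N \<le> ?S M" using M r by (intro sum_mono2) auto
    also have "?S M = (mean2 (?s M) r)\<^sup>2" using mean2_sum_powers[OF _ r, of "{..<M}"] by simp
    finally have "sqrt (?S N) \<le> mean2 (?s M) r" by (intro real_le_lsqrt) (auto simp: mean2_nonneg S0)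
    also have "\<dots> \<le> mean2 f r + mean2 (\<lambda>z. ?s M z - f z) r"
      using mean2_add_le[OF f _ r, of "\<lambda>z. ?s M z - f z"] f by (simp add: holomorphic_intros)
    finally show ?thesis using mean2_minus[of f "?s M"] by simp
  qed
  then have "\<forall>\<^sub>F M in sequentially. sqrt (?S N) \<le> mean2 f r + mean2 (\<lambda>z. f z - ?s M z) r"
    using eventually_sequentially by blast
  moreover have "(\<lambda>M. mean2 f r + mean2 (\<lambda>z. f z - ?s M z) r) \<longlonglongrightarrow> mean2 f r + 0"
    by (intro tendsto_intros mean2_taylor_tendsto f r)
  ultimately have "sqrt (?S N) \<le> mean2 f r"
    using tendsto_lowerbound[OF _ _ sequentially_bot] by fastforce
  then have "(sqrt (?S N))\<^sup>2 \<le> (mean2 f r)\<^sup>2" using S0 by (intro power_mono) auto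
  then show ?thesis using S0 by simp
qed

lemma norm_at_0_le_mean2:
  assumes "f holomorphic_on ball 0 1" "r \<in> {0..<1}"
  shows "norm (f 0) \<le> mean2 f r"
  using sum_taylor_le_mean2[OF assms, of 1] by (intro power2_le_imp_le[of "norm (f 0)"]) (auto simp: mean2_nonneg)

lemma tendsto_le_at_1:
  fixes P :: "real \<Rightarrow> real"
  assumes "continuous_on UNIV P" "\<And>r. r \<in> {0..<1} \<Longrightarrow> P r \<le> C"
  shows "P 1 \<le> C"
proof -
  have "(P \<longlongrightarrow> P 1) (at_left 1)"
    using assms(1) by (auto simp: continuous_on_def intro: tendsto_within_subset)
  moreover have "\<forall>\<^sub>F r in at_left 1. P r \<le> C"
    using eventually_at_left_real[of 0 "1::real"] by (rule eventually_mono) (use assms(2) in auto)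
  ultimately show ?thesis by (rule tendsto_upperbound) auto
qed

lemma sum_taylor_le:
  assumes f: "f holomorphic_on ball 0 1" and C: "\<And>r. r \<in> {0..<1} \<Longrightarrow> mean2 f r \<le> C"
  shows "(\<Sum>k<N. (norm (taylor_coeff f k))\<^sup>2) \<le> C\<^sup>2"
proof -
  have "(\<Sum>k<N. (norm (taylor_coeff f k))\<^sup>2 * r ^ (2 * k)) \<le> C\<^sup>2" if "r \<in> {0..<1}" for r
    using sum_taylor_le_mean2[OF f that, of N] power_mono[OF C[OF that] mean2_nonneg, of 2] by linarith
  from tendsto_le_at_1[of "\<lambda>r. \<Sum>k<N. (norm (taylor_coeff f k))\<^sup>2 * r ^ (2 * k)", OF _ this]
  show ?thesis by (simp add: continuous_intros)
qed

text \<open>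
  Bounded means make \<open>\<Sum>\<bar>a\<^sub>k\<bar>\<^sup>2\<close> finite. Its tail bounds the remainder of the Taylor series on all
  circles \<open>\<bar>z\<bar> = r < 1\<close> at once, so one Taylor polynomial serves for every \<open>r\<close>.
\<close>

lemma poly_dense_H2:
  assumes f: "f holomorphic_on ball 0 1" and C: "\<And>r. r \<in> {0..<1} \<Longrightarrow> mean2 f r \<le> C"
    and e: "e > 0"
  shows "\<exists>p. \<forall>r\<in>{0..<1}. mean2 (\<lambda>z. f z - poly p z) r \<le> e"
proof -
  let ?a = "taylor_coeff f"
  let ?s = "\<lambda>M z. \<Sum>k<M. ?a k * z ^ k"
  have b: "(\<Sum>k<M. (norm (?a k))\<^sup>2) \<le> C\<^sup>2" for M using sum_taylor_le[OF f C] by blast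
  have "summable (\<lambda>k. (norm (?a k))\<^sup>2)"
  proof (rule bounded_imp_summable[of _ "C\<^sup>2"])
    show "(\<Sum>k\<le>n. (norm (?a k))\<^sup>2) \<le> C\<^sup>2" for n
      using b[of "Suc n"] by (simp only: lessThan_Suc_atMost)
  qed simp
  moreover have "e\<^sup>2 > 0" using e by simp
  ultimately obtain N where N: "\<And>m n. m \<ge> N \<Longrightarrow> norm (\<Sum>k\<in>{m..<n}. (norm (?a k))\<^sup>2) < e\<^sup>2"
    unfolding summable_Cauchy by meson
  define p where "p = (\<Sum>k<N. monom (?a k) k)"
  have p: "poly p = ?s N" by (auto simp: p_def poly_sum poly_monom)
  have "mean2 (\<lambda>z. f z - ?s N z) r \<le> e" if r: "r \<in> {0..<1}" for r
  proof -
    have "mean2 (\<lambda>z. f z - ?s N z) r \<le> mean2 (\<lambda>z. f z - ?s M z) r + e" if M: "N \<le> M" for M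
    proof -
      have "?s M z - ?s N z = (\<Sum>k\<in>{N..<M}. ?a k * z ^ k)" for z
        using M sum_diff_nat_ivl[of 0 N M "\<lambda>k. ?a k * z ^ k"] by (simp add: atLeast0LessThan)
      then have "(mean2 (\<lambda>z. ?s M z - ?s N z) r)\<^sup>2 = (\<Sum>k\<in>{N..<M}. (norm (?a k))\<^sup>2 * r ^ (2 * k))"
        using mean2_sum_powers[OF _ r, of "{N..<M}"] by simp
      moreover have "(\<Sum>k\<in>{N..<M}. (norm (?a k))\<^sup>2 * r ^ (2 * k)) \<le> (\<Sum>k\<in>{N..<M}. (norm (?a k))\<^sup>2)"
        using r by (intro sum_mono mult_left_le power_le_one) auto
      moreover have "norm (\<Sum>k\<in>{N..<M}. (norm (?a k))\<^sup>2) < e\<^sup>2" using N by blast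
      ultimately have "(mean2 (\<lambda>z. ?s M z - ?s N z) r)\<^sup>2 \<le> e\<^sup>2"
        unfolding real_norm_def by linarith
      then have "mean2 (\<lambda>z. ?s M z - ?s N z) r \<le> e" by (rule power2_le_imp_le) (use e in simp)
      moreover have "mean2 (\<lambda>z. f z - ?s N z) r
          \<le> mean2 (\<lambda>z. f z - ?s M z) r + mean2 (\<lambda>z. ?s M z - ?s N z) r"
        using f r by (intro mean2_diff_le holomorphic_intros)
      ultimately show ?thesis by linarith
    qed
    then have "\<forall>\<^sub>F M in sequentially. mean2 (\<lambda>z. f z - ?s N z) r \<le> mean2 (\<lambda>z. f z - ?s M z) r + e"
      using eventually_sequentially by blast
    moreover have "(\<lambda>M. mean2 (\<lambda>z. f z - ?s M z) r + e) \<longlonglongrightarrow> 0 + e"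
      by (intro tendsto_intros mean2_taylor_tendsto f r)
    ultimately show ?thesis using tendsto_lowerbound[OF _ _ sequentially_bot] by fastforce
  qed
  then show ?thesis using p by (intro exI[of _ p]) simp
qed

section \<open>Outer functions and cyclicity\<close>

text \<open>
  The usable form of the cyclicity of an outer function: since multiplication by a polynomial is
  bounded on \<open>H\<^sup>2\<close> and the polynomials are dense, the closed span of the \<open>z\<^sup>k F\<close> is all of \<open>H\<^sup>2\<close> as soon
  as it contains the constant \<open>1\<close>. Only values on the open disc enter, so the predicate also applies
  to functions that do not vanish off the disc.
\<close>

definition cyclic :: "(complex \<Rightarrow> complex) \<Rightarrow> bool" where
  "cyclic F \<longleftrightarrow> (\<forall>e>0. \<exists>p. \<forall>r\<in>{0..<1}. mean2 (\<lambda>z. poly p z * F z - 1) r \<le> e)"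

lemma cyclicD: "cyclic F \<Longrightarrow> e > 0 \<Longrightarrow> \<exists>p. \<forall>r\<in>{0..<1}. mean2 (\<lambda>z. poly p z * F z - 1) r \<le> e"
  by (simp add: cyclic_def)

lemma poly_bounded_on_disc: "\<exists>M>0. \<forall>z. norm z < 1 \<longrightarrow> norm (poly p (z::complex)) \<le> M"
proof -
  have "bounded (poly p ` cball 0 1)"
    by (intro compact_imp_bounded compact_continuous_image continuous_intros compact_cball)
  then obtain M where "M > 0" "\<And>z. z \<in> cball 0 1 \<Longrightarrow> norm (poly p z) \<le> M"
    unfolding bounded_pos by blast
  then show ?thesis by (intro exI[of _ M]) auto
qed

lemma Metric_H2: "Metric_space H2 H2_dist"
  by (rule Metric_space_H2) simp

lemma H2_dist_lt:
  assumes "f \<in> H2" "g \<in> H2" "\<And>r. r \<in> {0..<1} \<Longrightarrow> mean2 (\<lambda>z. f z - g z) r \<le> e" "e < e'"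
  shows "H2_dist f g < e'"
  using H2_norm_le[of "\<lambda>z. f z - g z" e] assms by (simp add: H2_dist_def)

lemma outer_imp_cyclic:
  assumes "F \<in> outer_functions"
  shows "cyclic F"
  unfolding cyclic_def
proof (intro allI impI)
  fix e :: real assume e: "e > 0"
  interpret Metric_space H2 H2_dist by (rule Metric_H2)
  have one: "on_disc (\<lambda>z. 1) \<in> H2"
    using on_disc_Hinf[of "\<lambda>z. 1" 1] Hinf_subset_H2 by auto
  have "on_disc (\<lambda>z. 1) \<in> mtopology closure_of shift_span F"
    using assms one by (simp add: outer_functions_def H2_top_def)
  then obtain y where y: "y \<in> shift_span F" "y \<in> H2" "H2_dist (on_disc (\<lambda>z. 1)) y < e"
    using e unfolding metric_closure_of by auto
  obtain c m where y_eq: "y = (\<lambda>z. \<Sum>k<m. c k * (z ^ k * F z))"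
    using y(1) by (auto simp: shift_span_def)
  define p where "p = (\<Sum>k<m. monom (c k) k)"
  have y_p: "y z = poly p z * F z" for z
    by (simp add: y_eq p_def poly_sum poly_monom sum_distrib_right mult.assoc)
  have "mean2 (\<lambda>z. poly p z * F z - 1) r \<le> e" if r: "r \<in> {0..<1}" for r
  proof -
    have "mean2 (\<lambda>z. poly p z * F z - 1) r = mean2 (\<lambda>z. y z - on_disc (\<lambda>z. 1) z) r"
      using r by (intro mean2_cong) (auto simp: y_p on_disc_in)
    also have "\<dots> = mean2 (\<lambda>z. on_disc (\<lambda>z. 1) z - y z) r" by (subst mean2_minus) simp
    also have "\<dots> \<le> H2_norm (\<lambda>z. on_disc (\<lambda>z. 1) z - y z)"
      by (intro mean2_le_H2_norm H2_diff one y r)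
    also have "\<dots> < e" using y one by (simp add: H2_dist_def)
    finally show ?thesis by simp
  qed
  then show "\<exists>p. \<forall>r\<in>{0..<1}. mean2 (\<lambda>z. poly p z * F z - 1) r \<le> e" by blast
qed

lemma cyclic_imp_outer:
  assumes F: "F holomorphic_on ball 0 1" "\<And>z. norm z < 1 \<Longrightarrow> norm (F z) \<le> B" and cyc: "cyclic F"
  shows "on_disc F \<in> outer_functions"
proof -
  interpret Metric_space H2 H2_dist by (rule Metric_H2)
  have FH: "on_disc F \<in> Hinf" by (rule on_disc_Hinf) fact+
  have "h \<in> mtopology closure_of shift_span (on_disc F)" if h: "h \<in> H2" for h
    unfolding metric_closure_of
  proof (intro CollectI conjI allI impI h)
    fix e :: real assume e: "e > 0"
    have hh: "h holomorphic_on ball 0 1" using h by (simp add: H2_def Hol_disc_def)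
    obtain p where p: "\<And>r. r \<in> {0..<1} \<Longrightarrow> mean2 (\<lambda>z. h z - poly p z) r \<le> e / 3"
      using poly_dense_H2[OF hh mean2_le_H2_norm[OF h], of "e / 3"] e by (meson divide_pos_pos zero_less_numeral)
    obtain M where M: "M > 0" "\<And>z. norm z < 1 \<Longrightarrow> norm (poly p z) \<le> M"
      using poly_bounded_on_disc by blast
    obtain q where q: "\<And>r. r \<in> {0..<1} \<Longrightarrow> mean2 (\<lambda>z. poly q z * F z - 1) r \<le> e / (3 * M)"
      using cyclicD[OF cyc, of "e / (3 * M)"] e M by (meson divide_pos_pos mult_pos_pos zero_less_numeral)
    define y where "y = (\<lambda>z. poly (p * q) z * on_disc F z)"
    have "y = (\<lambda>z. \<Sum>k<Suc (degree (p * q)). coeff (p * q) k * (z ^ k * on_disc F z))"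
      unfolding y_def poly_altdef by (simp only: sum_distrib_right lessThan_Suc_atMost mult.assoc)
    then have ys: "y \<in> shift_span (on_disc F)" unfolding shift_span_def by blast
    obtain K where K: "\<And>z. norm z < 1 \<Longrightarrow> norm (poly (p * q) z) \<le> K"
      using poly_bounded_on_disc by blast
    have "y = on_disc (\<lambda>z. poly (p * q) z * F z)" by (auto simp: y_def on_disc_def)
    also have "\<dots> \<in> Hinf"
    proof (rule on_disc_Hinf)
      show "norm (poly (p * q) z * F z) \<le> K * B" if "norm z < 1" for z
        unfolding norm_mult
      proof (rule mult_mono)
        show "0 \<le> K" using K[OF that] norm_ge_zero order_trans by blast
      qed (use K[OF that] F(2)[OF that] in auto)
    qed (intro holomorphic_intros F)
    finally have yH: "y \<in> H2" using Hinf_subset_H2 by blast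
    have "H2_dist h y < e"
    proof (rule H2_dist_lt[OF h yH])
      fix r :: real assume r: "r \<in> {0..<1}"
      have "mean2 (\<lambda>z. h z - y z) r = mean2 (\<lambda>z. h z - poly p z * poly q z * F z) r"
        using r by (intro mean2_cong) (auto simp: y_def on_disc_in)
      also have "\<dots> \<le> mean2 (\<lambda>z. h z - poly p z) r + mean2 (\<lambda>z. poly p z - poly p z * poly q z * F z) r"
        using hh F r by (intro mean2_diff_le holomorphic_intros)
      also have "mean2 (\<lambda>z. poly p z - poly p z * poly q z * F z) r
           = mean2 (\<lambda>z. poly p z * (1 - poly q z * F z)) r" by (simp add: algebra_simps)
      also have "\<dots> \<le> M * mean2 (\<lambda>z. 1 - poly q z * F z) r"
        using F r M by (intro mean2_mult_le holomorphic_intros)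
      also have "mean2 (\<lambda>z. 1 - poly q z * F z) r = mean2 (\<lambda>z. poly q z * F z - 1) r"
        by (subst mean2_minus) simp
      also have "M * \<dots> \<le> M * (e / (3 * M))" using q[OF r] M by (intro mult_left_mono) auto
      finally show "mean2 (\<lambda>z. h z - y z) r \<le> e / 3 + e / 3"
        using p[OF r] M by simp
    qed (use e in simp)
    then show "\<exists>y\<in>shift_span (on_disc F). y \<in> mball h e"
      using ys yH h unfolding in_mball by blast
  qed
  moreover have "mtopology closure_of shift_span (on_disc F) \<subseteq> H2"
    using closure_of_subset_topspace[of mtopology "shift_span (on_disc F)"] by (simp only: topspace_mtopology)
  ultimately have "mtopology closure_of shift_span (on_disc F) = H2" by blast
  then show ?thesis using FH by (simp add: outer_functions_def H2_top_def)
qed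

section \<open>Multiplication by an inner function\<close>

lemma inner_hol: "u \<in> inner_functions \<Longrightarrow> u holomorphic_on ball 0 1"
  by (simp add: inner_functions_def Hinf_def Hol_disc_def)

text \<open>
  The difference of the two squared means is the mean of \<open>\<bar>g\<bar>\<^sup>2 (1 - \<bar>u\<bar>\<^sup>2)\<close>. On the circles of radius
  \<open>1 - 1/(j+1)\<close> this is bounded and tends to \<open>0\<close> along almost every radius, so dominated convergence
  applies.
\<close>

lemma inner_isometry:
  assumes u: "u \<in> inner_functions" and g: "g holomorphic_on ball 0 1"
    and B: "\<And>z. norm z < 1 \<Longrightarrow> norm (g z) \<le> B"
  shows "(\<lambda>j. (mean2 g (1 - inverse (Suc j)))\<^sup>2 - (mean2 (\<lambda>z. u z * g z) (1 - inverse (Suc j)))\<^sup>2)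
     \<longlonglongrightarrow> 0"
proof -
  define \<rho> where "\<rho> j = 1 - inverse (real (Suc j))" for j
  have \<rho>: "\<rho> j \<in> {0..<1}" for j by (auto simp: \<rho>_def field_simps)
  have \<rho>_lim: "filterlim \<rho> (at_left 1) sequentially"
  proof -
    have "\<rho> \<longlonglongrightarrow> 1 - 0" unfolding \<rho>_def by (intro tendsto_intros LIMSEQ_inverse_real_of_nat)
    moreover have "\<rho> j \<noteq> 1" for j using \<rho>[of j] by auto
    ultimately show ?thesis using \<rho> by (auto simp: filterlim_at)
  qed
  have uh: "u holomorphic_on ball 0 1" by (rule inner_hol[OF u])
  have uH: "u \<in> Hinf" using u by (simp add: inner_functions_def)
  obtain A where A: "\<And>z. norm (u z) \<le> A" using Hinf_bound[OF uH] by blast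
  let ?M = "lebesgue_on {0..2 * pi}"
  define D where "D j t = (norm (g (of_real (\<rho> j) * cis t)))\<^sup>2 - (norm (u (of_real (\<rho> j) * cis t) * g (of_real (\<rho> j) * cis t)))\<^sup>2"
    for j t
  have D_eq: "D j t = (norm (g (of_real (\<rho> j) * cis t)))\<^sup>2 * (1 - (norm (u (of_real (\<rho> j) * cis t)))\<^sup>2)" for j t
    by (simp add: D_def norm_mult power_mult_distrib algebra_simps)
  have in_disc: "norm (of_real (\<rho> j) * cis t) < 1" for j t using \<rho>[of j] by (simp add: norm_mult)
  have cont: "continuous_on {0..2*pi} (\<lambda>t. h (of_real (\<rho> j) * cis t))" if "h holomorphic_on ball 0 1" for h j
    using continuous_on_circle[OF on_disc_Hol_disc[OF that] \<rho>] in_disc by (simp add: on_disc_in)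
  have contD: "continuous_on {0..2*pi} (D j)" for j
    unfolding D_def by (intro continuous_intros cont uh g)
  have g2: "(norm (g (of_real (\<rho> j) * cis t)))\<^sup>2 \<le> B\<^sup>2" for j t
    using B[OF in_disc] by (intro power_mono) auto
  have meas: "D j \<in> borel_measurable ?M" for j
    by (intro continuous_imp_measurable_on_sets_lebesgue contD) auto
  have bound: "norm (D j t) \<le> B\<^sup>2 * (1 + A\<^sup>2)" for j t
  proof -
    have "(norm (u (of_real (\<rho> j) * cis t)))\<^sup>2 \<le> A\<^sup>2" using A by (intro power_mono) auto
    then have "\<bar>1 - (norm (u (of_real (\<rho> j) * cis t)))\<^sup>2\<bar> \<le> 1 + A\<^sup>2"
      using zero_le_power2[of "norm (u (of_real (\<rho> j) * cis t))"] zero_le_power2[of A] by linarith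
    then show ?thesis unfolding D_eq using g2 by (auto simp: abs_mult intro!: mult_mono)
  qed
  interpret fm: finite_measure ?M by (rule finite_measure_lebesgue_on) simp
  have int: "integrable ?M (D j)" for j
    by (rule fm.integrable_const_bound[of _ "B\<^sup>2 * (1 + A\<^sup>2)"]) (use bound meas in auto)
  have "AE t in ?M. (\<lambda>j. D j t) \<longlonglongrightarrow> 0"
  proof -
    have "AE t in ?M. \<exists>l. norm l = 1 \<and> ((\<lambda>r. u (of_real r * cis t)) \<longlongrightarrow> l) (at_left 1)"
      using u by (simp add: inner_functions_def)
    then show ?thesis
    proof (rule AE_mp, intro AE_I2 impI)
      fix t assume "\<exists>l. norm l = 1 \<and> ((\<lambda>r. u (of_real r * cis t)) \<longlongrightarrow> l) (at_left 1)"
      then obtain l where l: "norm l = 1" "((\<lambda>r. u (of_real r * cis t)) \<longlongrightarrow> l) (at_left 1)" by blast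
      have "(\<lambda>j. u (of_real (\<rho> j) * cis t)) \<longlonglongrightarrow> l"
        using filterlim_compose[OF l(2) \<rho>_lim] .
      then have "(\<lambda>j. B\<^sup>2 * \<bar>1 - (norm (u (of_real (\<rho> j) * cis t)))\<^sup>2\<bar>) \<longlonglongrightarrow> B\<^sup>2 * \<bar>1 - (norm l)\<^sup>2\<bar>"
        by (intro tendsto_intros)
      then have lim0: "(\<lambda>j. B\<^sup>2 * \<bar>1 - (norm (u (of_real (\<rho> j) * cis t)))\<^sup>2\<bar>) \<longlonglongrightarrow> 0" using l by simp
      show "(\<lambda>j. D j t) \<longlonglongrightarrow> 0"
        by (rule Lim_null_comparison[OF _ lim0])
           (use g2 in \<open>auto simp: D_eq abs_mult intro!: always_eventually mult_right_mono\<close>)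
    qed
  qed
  then have "(\<lambda>j. integral\<^sup>L ?M (D j)) \<longlonglongrightarrow> integral\<^sup>L ?M (\<lambda>t. 0)"
    by (intro integral_dominated_convergence[of _ _ _ "\<lambda>t. B\<^sup>2 * (1 + A\<^sup>2)"]) (use meas bound in auto)
  moreover have "integral\<^sup>L ?M (D j) = integral {0..2*pi} (D j)" for j
    by (rule lebesgue_integral_eq_integral[OF int]) simp
  ultimately have "(\<lambda>j. 1 / (2*pi) * integral {0..2*pi} (D j)) \<longlonglongrightarrow> 1 / (2*pi) * 0"
    by (intro tendsto_intros) simp
  moreover have "1 / (2*pi) * integral {0..2*pi} (D j) = (mean2 g (\<rho> j))\<^sup>2 - (mean2 (\<lambda>z. u z * g z) (\<rho> j))\<^sup>2" for j
  proof -
    have "(\<lambda>t. (norm (g (of_real (\<rho> j) * cis t)))\<^sup>2) integrable_on {0..2*pi}"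
      "(\<lambda>t. (norm (u (of_real (\<rho> j) * cis t) * g (of_real (\<rho> j) * cis t)))\<^sup>2) integrable_on {0..2*pi}"
      by (intro integrable_continuous_interval continuous_intros cont uh g)+
    then have "integral {0..2*pi} (D j) = integral {0..2*pi} (\<lambda>t. (norm (g (of_real (\<rho> j) * cis t)))\<^sup>2)
      - integral {0..2*pi} (\<lambda>t. (norm (u (of_real (\<rho> j) * cis t) * g (of_real (\<rho> j) * cis t)))\<^sup>2)"
      unfolding D_def by (rule Henstock_Kurzweil_Integration.integral_diff)
    then show ?thesis
      using mean2_square_hol[OF g \<rho>] mean2_square_hol[OF holomorphic_on_mult[OF uh g] \<rho>]
      by (simp add: right_diff_distrib diff_divide_distrib)
  qed
  ultimately show ?thesis unfolding \<rho>_def by (simp only: mult_zero_right)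
qed

lemma one_minus_inverse_Suc: "1 - inverse (real (Suc j)) \<in> {0..<1}"
  by (auto simp: field_simps)

text \<open>
  The value at the centre is at most the quadratic mean over any circle, and close to the unit circle
  the means of \<open>g\<close> and \<open>u g\<close> are nearly the same.
\<close>

lemma inner_factor_at_0:
  assumes u: "u \<in> inner_functions" and g: "g holomorphic_on ball 0 1"
    and B: "\<And>z. norm z < 1 \<Longrightarrow> norm (g z) \<le> B"
    and C: "\<And>r. r \<in> {0..<1} \<Longrightarrow> mean2 (\<lambda>z. u z * g z) r \<le> C"
  shows "norm (g 0) \<le> C"
proof -
  let ?\<rho> = "\<lambda>j. 1 - inverse (real (Suc j))"
  have "(norm (g 0))\<^sup>2 \<le> ((mean2 g (?\<rho> j))\<^sup>2 - (mean2 (\<lambda>z. u z * g z) (?\<rho> j))\<^sup>2) + C\<^sup>2" for j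
  proof -
    note \<rho> = one_minus_inverse_Suc[of j]
    have "(norm (g 0))\<^sup>2 \<le> (mean2 g (?\<rho> j))\<^sup>2"
      using norm_at_0_le_mean2[OF g \<rho>] by (intro power_mono) auto
    moreover have "(mean2 (\<lambda>z. u z * g z) (?\<rho> j))\<^sup>2 \<le> C\<^sup>2"
      using C[OF \<rho>] by (intro power_mono) (auto simp: mean2_nonneg)
    ultimately show ?thesis by linarith
  qed
  then have "\<forall>\<^sub>F j in sequentially. (norm (g 0))\<^sup>2 \<le> ((mean2 g (?\<rho> j))\<^sup>2 - (mean2 (\<lambda>z. u z * g z) (?\<rho> j))\<^sup>2) + C\<^sup>2"
    by simp
  moreover have "(\<lambda>j. ((mean2 g (?\<rho> j))\<^sup>2 - (mean2 (\<lambda>z. u z * g z) (?\<rho> j))\<^sup>2) + C\<^sup>2) \<longlonglongrightarrow> 0 + C\<^sup>2"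
    by (intro tendsto_add inner_isometry[OF u g B] tendsto_const)
  ultimately have "(norm (g 0))\<^sup>2 \<le> 0 + C\<^sup>2"
    by (intro tendsto_lowerbound[OF _ _ sequentially_bot])
  moreover have "0 \<le> C" using C[of 0] mean2_nonneg[of "\<lambda>z. u z * g z" 0] by simp
  ultimately show ?thesis using power2_le_imp_le[of "norm (g 0)" C] by simp
qed

text \<open>
  The quantitative heart of the proof. If \<open>u g\<close> is within \<open>e\<close> of \<open>1\<close> in mean square, then
  \<open>\<bar>u(0) g(0)\<bar> \<ge> 1 - e\<close>, whereas \<open>\<bar>g(0)\<bar>\<close> is at most the \<open>H\<^sup>2\<close> norm of \<open>g\<close>, which is that of \<open>u g\<close> and
  hence at most \<open>1 + e\<close>. So an inner factor of a function close to \<open>1\<close> is itself large at \<open>0\<close>.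
\<close>

lemma inner_near_one_at_0:
  assumes u: "u \<in> inner_functions" and g: "g holomorphic_on ball 0 1"
    and B: "\<And>z. norm z < 1 \<Longrightarrow> norm (g z) \<le> B"
    and e: "\<And>r. r \<in> {0..<1} \<Longrightarrow> mean2 (\<lambda>z. u z * g z - 1) r \<le> e"
  shows "1 - e \<le> norm (u 0) * (1 + e)"
proof -
  note uh = inner_hol[OF u]
  have le: "mean2 (\<lambda>z. u z * g z) r \<le> 1 + e" if r: "r \<in> {0..<1}" for r
    using mean2_add_le[of "\<lambda>z. 1" "\<lambda>z. u z * g z - 1" r] uh g r e[OF r]
    by (simp add: holomorphic_intros mean2_one)
  have "norm (g 0) \<le> 1 + e" by (rule inner_factor_at_0[OF u g]) (use B le in auto)
  then have "norm (u 0) * norm (g 0) \<le> norm (u 0) * (1 + e)" by (intro mult_left_mono) auto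
  moreover have "norm (u 0 * g 0 - 1) \<le> e"
    using norm_at_0_le_mean2[of "\<lambda>z. u z * g z - 1" 0] e[of 0] uh g by (simp add: holomorphic_intros)
  moreover have "1 - norm (u 0 * g 0 - 1) \<le> norm (u 0 * g 0)"
    using norm_triangle_ineq2[of 1 "1 - u 0 * g 0"] by (simp add: norm_minus_commute)
  ultimately show ?thesis by (simp add: norm_mult)
qed

text \<open>
  Multiplying \<open>V = u g\<close> by polynomials that bring \<open>V\<close> close to \<open>1\<close> puts the previous estimate to work
  with arbitrarily small \<open>e\<close>. With \<open>inner_constant\<close> below: an outer function has only constant inner factors.
\<close>

lemma cyclic_inner_factor:
  assumes V: "cyclic V" and u: "u \<in> inner_functions" and g: "g holomorphic_on ball 0 1"
    and B: "\<And>z. norm z < 1 \<Longrightarrow> norm (g z) \<le> B"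
    and V_eq: "\<And>z. norm z < 1 \<Longrightarrow> V z = u z * g z"
  shows "1 \<le> norm (u 0)"
proof (rule ccontr)
  define x where "x = norm (u 0)"
  assume "\<not> 1 \<le> norm (u 0)"
  then have x: "x < 1" "0 \<le> x" by (auto simp: x_def)
  \<comment> \<open>small enough that \<open>1 - e \<le> x (1 + e)\<close> forces \<open>(1 - x) (3 - x) \<le> 0\<close>\<close>
  define e where "e = (1 - x) / 4"
  have "e > 0" using x by (simp add: e_def)
  then obtain p where p: "\<And>r. r \<in> {0..<1} \<Longrightarrow> mean2 (\<lambda>z. poly p z * V z - 1) r \<le> e"
    using cyclicD[OF V] by blast
  obtain M where M: "M > 0" "\<And>z. norm z < 1 \<Longrightarrow> norm (poly p z) \<le> M"
    using poly_bounded_on_disc by blast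
  have "1 - e \<le> x * (1 + e)"
    unfolding x_def
  proof (rule inner_near_one_at_0[OF u])
    show "(\<lambda>z. poly p z * g z) holomorphic_on ball 0 1" by (intro holomorphic_intros g)
    show "norm (poly p z * g z) \<le> M * B" if "norm z < 1" for z
      unfolding norm_mult using M B[OF that] that by (intro mult_mono) auto
    show "mean2 (\<lambda>z. u z * (poly p z * g z) - 1) r \<le> e" if r: "r \<in> {0..<1}" for r
      using p[OF r] mean2_cong[of "\<lambda>z. poly p z * V z - 1" "\<lambda>z. u z * (poly p z * g z) - 1" r] r V_eq
      by (simp add: mult_ac)
  qed
  then have "(1 - x) * (3 - x) \<le> 0" by (simp add: e_def field_simps)
  moreover have "(1 - x) * (3 - x) > 0" using x by (intro mult_pos_pos) auto
  ultimately show False by linarith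
qed

text \<open>
  By the isometry the squares of all Taylor coefficients of \<open>u\<close> sum to at most \<open>1\<close>, and the
  coefficient \<open>u(0)\<close> already uses up this amount.
\<close>

lemma inner_constant:
  assumes u: "u \<in> inner_functions" and 1: "1 \<le> norm (u 0)"
  shows "norm (u 0) = 1" "norm z < 1 \<Longrightarrow> u z = u 0"
proof -
  let ?\<rho> = "\<lambda>j. 1 - inverse (real (Suc j))"
  let ?a = "taylor_coeff u"
  note uh = inner_hol[OF u]
  have lim: "(\<lambda>j. 1 - (mean2 u (?\<rho> j))\<^sup>2) \<longlonglongrightarrow> 0"
    using inner_isometry[OF u, of "\<lambda>z. 1" 1] by (simp add: mean2_one)
  have le: "(\<Sum>k<N. (norm (?a k))\<^sup>2) \<le> 1" for N
  proof -
    have "(\<lambda>j. (\<Sum>k<N. (norm (?a k))\<^sup>2 * ?\<rho> j ^ (2 * k)) + (1 - (mean2 u (?\<rho> j))\<^sup>2))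
        \<longlonglongrightarrow> (\<Sum>k<N. (norm (?a k))\<^sup>2 * (1 - 0) ^ (2 * k)) + 0"
      by (intro tendsto_intros lim LIMSEQ_inverse_real_of_nat)
    moreover have "(\<Sum>k<N. (norm (?a k))\<^sup>2 * ?\<rho> j ^ (2 * k)) + (1 - (mean2 u (?\<rho> j))\<^sup>2) \<le> 1" for j
      using sum_taylor_le_mean2[OF uh one_minus_inverse_Suc[of j], of N] by linarith
    then have "\<forall>\<^sub>F j in sequentially.
        (\<Sum>k<N. (norm (?a k))\<^sup>2 * ?\<rho> j ^ (2 * k)) + (1 - (mean2 u (?\<rho> j))\<^sup>2) \<le> 1"
      by (rule always_eventually[OF allI])
    ultimately have "(\<Sum>k<N. (norm (?a k))\<^sup>2 * (1 - 0) ^ (2 * k)) + 0 \<le> 1"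
      by (rule tendsto_upperbound) simp
    then show ?thesis by simp
  qed
  show one: "norm (u 0) = 1" using le[of 1] 1 abs_square_le_1[of "norm (u 0)"] by simp
  have zero: "?a k = 0" if "k > 0" for k
  proof -
    have "(\<Sum>k\<in>{0, k}. (norm (?a k))\<^sup>2) \<le> (\<Sum>k<Suc k. (norm (?a k))\<^sup>2)" by (intro sum_mono2) auto
    then have "(norm (u 0))\<^sup>2 + (norm (?a k))\<^sup>2 \<le> 1" using le[of "Suc k"] that by simp
    then show ?thesis using one by simp
  qed
  show "u z = u 0" if z: "norm z < 1"
  proof -
    have "(\<lambda>k. ?a k * z ^ k) = (\<lambda>k. if k = 0 then u 0 else 0)" using zero by (auto simp: fun_eq_iff)
    then have "(\<lambda>k. ?a k * z ^ k) sums u 0" using sums_single[of 0 "\<lambda>_. u 0"] by (simp only:)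
    with taylor_sums[OF uh z] show ?thesis by (rule sums_unique2)
  qed
qed

section \<open>Functions continuous up to the circle\<close>

definition disc_algebra :: "(complex \<Rightarrow> complex) \<Rightarrow> bool" where
  "disc_algebra f \<longleftrightarrow> continuous_on (cball 0 1) f \<and> f holomorphic_on ball 0 1"

lemma disc_algebra_cont: "disc_algebra f \<Longrightarrow> continuous_on (cball 0 1) f"
  and disc_algebra_hol: "disc_algebra f \<Longrightarrow> f holomorphic_on ball 0 1"
  by (auto simp: disc_algebra_def)

lemma disc_algebra_intros:
  "disc_algebra (\<lambda>z. c)" "disc_algebra (\<lambda>z. z)" "disc_algebra (poly p)"
  "disc_algebra f \<Longrightarrow> disc_algebra g \<Longrightarrow> disc_algebra (\<lambda>z. f z * g z)"
  "disc_algebra f \<Longrightarrow> disc_algebra g \<Longrightarrow> disc_algebra (\<lambda>z. f z + g z)"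
  "disc_algebra f \<Longrightarrow> disc_algebra g \<Longrightarrow> disc_algebra (\<lambda>z. f z - g z)"
  "disc_algebra f \<Longrightarrow> disc_algebra (\<lambda>z. - f z)"
  "disc_algebra f \<Longrightarrow> disc_algebra g \<Longrightarrow> (\<And>z. norm z \<le> 1 \<Longrightarrow> g z \<noteq> 0) \<Longrightarrow> disc_algebra (\<lambda>z. f z / g z)"
  unfolding disc_algebra_def by (auto intro!: continuous_intros holomorphic_intros)

lemma disc_algebra_bound:
  assumes "disc_algebra f"
  shows "\<exists>B>0. \<forall>z. norm z \<le> 1 \<longrightarrow> norm (f z) \<le> B"
proof -
  have "bounded (f ` cball 0 1)"
    by (intro compact_imp_bounded compact_continuous_image disc_algebra_cont assms compact_cball)
  then obtain B where "B > 0" "\<And>z. z \<in> cball 0 1 \<Longrightarrow> norm (f z) \<le> B"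
    unfolding bounded_pos by blast
  then show ?thesis by (intro exI[of _ B]) auto
qed

lemma disc_algebra_max_modulus:
  assumes "disc_algebra f" "\<And>z. norm z = 1 \<Longrightarrow> norm (f z) \<le> B" "norm z \<le> 1"
  shows "norm (f z) \<le> B"
  by (rule maximum_modulus_frontier[of f "cball 0 1"])
     (use assms in \<open>auto simp: disc_algebra_def\<close>)

lemma disc_algebra_Hinf: "disc_algebra f \<Longrightarrow> on_disc f \<in> Hinf"
  using disc_algebra_bound[of f] disc_algebra_hol[of f] on_disc_Hinf[of f] by (meson less_imp_le)

lemma disc_algebra_radial_limit:
  assumes "disc_algebra f"
  shows "((\<lambda>r. f (of_real r * cis t)) \<longlongrightarrow> f (cis t)) (at_left 1)"
proof -
  have "continuous_on {0..1} (\<lambda>r. f (of_real r * cis t))"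
    by (rule continuous_on_compose2[OF disc_algebra_cont[OF assms]])
       (auto intro!: continuous_intros simp: norm_mult)
  then have "((\<lambda>r. f (of_real r * cis t)) \<longlongrightarrow> f (of_real 1 * cis t)) (at 1 within {0..1})"
    unfolding continuous_on_def by (rule bspec) simp
  moreover have "at 1 within {0..1} = (at_left (1::real))"
    by (rule at_within_Icc_at_left) simp
  ultimately show ?thesis by simp
qed

lemma eventually_at_left_1_disc: "\<forall>\<^sub>F r in at_left 1. norm (of_real r * cis t) < 1"
  using eventually_at_left_real[of 0 "1::real"] by (rule eventually_mono) (auto simp: norm_mult)

lemma disc_algebra_inner:
  assumes u: "disc_algebra u" and 1: "\<And>z. norm z = 1 \<Longrightarrow> norm (u z) = 1"
  shows "on_disc u \<in> inner_functions"
proof -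
  have "((\<lambda>r. on_disc u (of_real r * cis t)) \<longlongrightarrow> u (cis t)) (at_left 1)" for t
    using disc_algebra_radial_limit[OF u]
    by (rule Lim_transform_eventually, intro eventually_mono[OF eventually_at_left_1_disc[of t]])
       (simp add: on_disc_in)
  then have "\<exists>l. norm l = 1 \<and> ((\<lambda>r. on_disc u (of_real r * cis t)) \<longlongrightarrow> l) (at_left 1)" for t
    using 1[of "cis t"] by (intro exI[of _ "u (cis t)"]) simp
  then show ?thesis using disc_algebra_Hinf[OF u] by (simp add: inner_functions_def)
qed

section \<open>Finite Blaschke products\<close>

text \<open>
  For \<open>a \<noteq> 0\<close> the unimodular constant \<open>\<bar>a\<bar>/a\<close> makes the value at \<open>0\<close> positive, so that products are
  normalized. It has no limit as \<open>a\<close> tends to \<open>0\<close>, which is why the multiplicity of the zero at \<open>0\<close> has to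
  stay fixed for the factors to depend continuously on the function.
\<close>

definition blaschke_factor :: "complex \<Rightarrow> complex \<Rightarrow> complex" where
  "blaschke_factor a z = (if a = 0 then z else cnj (sgn a) * (a - z) / (1 - cnj a * z))"

definition blaschke :: "complex list \<Rightarrow> complex \<Rightarrow> complex" where
  "blaschke as z = (\<Prod>a\<leftarrow>as. blaschke_factor a z)"

text \<open>
  The cofactor of the Blaschke factor in \<open>z - a\<close>; it is zero-free on the open disc.
\<close>

definition blaschke_unit :: "complex \<Rightarrow> complex \<Rightarrow> complex" where
  "blaschke_unit a z = (if a = 0 then 1 else - sgn a * (1 - cnj a * z))"

lemma blaschke_Nil [simp]: "blaschke [] z = 1"
  and blaschke_Cons [simp]: "blaschke (a # as) z = blaschke_factor a z * blaschke as z"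
  by (simp_all add: blaschke_def)

lemma one_minus_cnj_mult_nonzero:
  assumes "norm a < 1" "norm z \<le> 1"
  shows "1 - cnj a * z \<noteq> (0::complex)"
proof
  assume "1 - cnj a * z = 0"
  then have "norm (cnj a * z) = 1" by (metis eq_iff_diff_eq_0 norm_one)
  moreover have "norm a * norm z < 1"
    using assms mult_left_le[of "norm z" "norm a"] by simp
  ultimately show False by (simp add: norm_mult)
qed

lemma cnj_sgn_mult: "cnj (sgn a) * a = of_real (norm a)"
proof (cases "a = 0")
  case False
  have "cnj a * a = of_real (norm a) * of_real (norm a)"
    using complex_norm_square[of a] by (simp add: power2_eq_square mult.commute)
  then show ?thesis using False by (simp add: sgn_eq)
qed simp

lemma cnj_sgn_mult_sgn: "a \<noteq> 0 \<Longrightarrow> cnj (sgn a) * sgn a = 1"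
  using cnj_sgn_mult[of a] by (simp add: sgn_eq[of a])

lemma blaschke_factor_unit:
  assumes "norm a < 1" "norm z \<le> 1"
  shows "blaschke_factor a z * blaschke_unit a z = z - a"
proof (cases "a = 0")
  case False
  have "cnj (sgn a) * (a - z) / (1 - cnj a * z) * (- sgn a * (1 - cnj a * z))
      = (cnj (sgn a) * sgn a) * (z - a)"
    using one_minus_cnj_mult_nonzero[OF assms] by (simp add: field_simps)
  then show ?thesis using False cnj_sgn_mult_sgn[of a] by (simp add: blaschke_factor_def blaschke_unit_def)
qed (simp add: blaschke_factor_def blaschke_unit_def)

lemma blaschke_factor_disc_algebra: "norm a < 1 \<Longrightarrow> disc_algebra (blaschke_factor a)"
  unfolding blaschke_factor_def [abs_def]
  using one_minus_cnj_mult_nonzero[of a] by (cases "a = 0") (simp_all add: disc_algebra_intros)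

lemma blaschke_unit_disc_algebra: "disc_algebra (blaschke_unit a)"
  unfolding blaschke_unit_def [abs_def] by (cases "a = 0") (auto intro!: disc_algebra_intros)

lemma norm_one_minus_cnj_mult:
  assumes "norm z = 1"
  shows "norm (1 - cnj a * z) = norm (z - a)"
proof -
  have "1 - cnj a * z = z * cnj (z - a)"
    using assms complex_norm_square[of z] by (simp add: algebra_simps)
  then show ?thesis using assms by (simp add: norm_mult del: complex_cnj_diff)
qed

lemma norm_blaschke_factor_circle:
  assumes "norm a < 1" "norm z = 1"
  shows "norm (blaschke_factor a z) = 1"
proof (cases "a = 0")
  case False
  have "z \<noteq> a" using assms by auto
  then show ?thesis using False assms
    by (simp add: blaschke_factor_def norm_mult norm_divide norm_sgn norm_one_minus_cnj_mult norm_minus_commute)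
qed (use assms in \<open>simp add: blaschke_factor_def\<close>)

lemma blaschke_factor_0: "blaschke_factor a 0 = of_real (norm a)"
  by (simp add: blaschke_factor_def cnj_sgn_mult)

lemma blaschke_factor_eq_0_iff:
  assumes "norm a < 1" "norm z \<le> 1"
  shows "blaschke_factor a z = 0 \<longleftrightarrow> z = a"
  using one_minus_cnj_mult_nonzero[OF assms] by (auto simp: blaschke_factor_def sgn_eq_0_iff)

text \<open>
  From \<open>1 - b\<^sub>a(z) = (1 - \<bar>a\<bar>) (1 + z \<bar>a\<bar>/a) / (1 - cnj a z)\<close>, where on the circle the denominator has
  modulus \<open>\<bar>z - a\<bar>\<close>: a factor whose zero is close to the circle is close to \<open>1\<close> away from that zero.
\<close>

lemma norm_one_minus_blaschke_factor:
  assumes a: "norm a < 1" "a \<noteq> 0" and z: "norm z = 1"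
  shows "norm (1 - blaschke_factor a z) \<le> 2 * (1 - norm a) / norm (z - a)"
proof -
  have nz: "1 - cnj a * z \<noteq> 0" using one_minus_cnj_mult_nonzero[of a z] a z by simp
  have s: "cnj (sgn a) * a = of_real (norm a)" by (rule cnj_sgn_mult)
  have s': "of_real (norm a) * cnj (sgn a) = cnj a"
    using a by (simp add: sgn_eq)
  have "1 - blaschke_factor a z = (1 - cnj a * z - cnj (sgn a) * a + cnj (sgn a) * z) / (1 - cnj a * z)"
    using nz a by (simp add: blaschke_factor_def field_simps)
  also have "1 - cnj a * z - cnj (sgn a) * a + cnj (sgn a) * z = of_real (1 - norm a) * (1 + cnj (sgn a) * z)"
    using s s' by (simp add: algebra_simps)
  finally have "norm (1 - blaschke_factor a z)
      = norm (of_real (1 - norm a) * (1 + cnj (sgn a) * z)) / norm (z - a)"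
    by (simp add: norm_divide norm_one_minus_cnj_mult[OF z])
  also have "norm (of_real (1 - norm a) * (1 + cnj (sgn a) * z)) \<le> 2 * (1 - norm a)"
  proof -
    have "norm (1 + cnj (sgn a) * z) \<le> 2"
      using norm_triangle_ineq[of 1 "cnj (sgn a) * z"] a z by (simp add: norm_mult norm_sgn)
    then have "norm (1 + cnj (sgn a) * z) * (1 - norm a) \<le> 2 * (1 - norm a)"
      using a by (intro mult_right_mono) auto
    moreover have "norm (complex_of_real (1 - norm a)) = 1 - norm a"
      using a by (simp only: norm_of_real)
    ultimately show ?thesis by (simp only: norm_mult mult.commute)
  qed
  finally show ?thesis by (simp add: divide_right_mono)
qed

lemma blaschke_disc_algebra:
  "(\<And>a. a \<in> set as \<Longrightarrow> norm a < 1) \<Longrightarrow> disc_algebra (blaschke as)"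
proof (induction as)
  case Nil
  show ?case using disc_algebra_intros(1)[of 1] by (simp add: blaschke_def [abs_def])
next
  case (Cons a as)
  have "disc_algebra (\<lambda>z. blaschke_factor a z * blaschke as z)"
    using Cons by (intro disc_algebra_intros blaschke_factor_disc_algebra) auto
  then show ?case by (simp add: fun_eq_iff cong: arg_cong[of _ _ disc_algebra] flip: blaschke_Cons)
qed

lemma norm_blaschke_circle:
  "(\<And>a. a \<in> set as \<Longrightarrow> norm a < 1) \<Longrightarrow> norm z = 1 \<Longrightarrow> norm (blaschke as z) = 1"
  by (induction as) (auto simp: norm_mult norm_blaschke_factor_circle)

lemma norm_blaschke_le:
  assumes "\<And>a. a \<in> set as \<Longrightarrow> norm a < 1" "norm z \<le> 1"
  shows "norm (blaschke as z) \<le> 1"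
  using disc_algebra_max_modulus[OF blaschke_disc_algebra] norm_blaschke_circle assms
  by (metis order_refl)

lemma blaschke_eq_0_iff:
  "(\<And>a. a \<in> set as \<Longrightarrow> norm a < 1) \<Longrightarrow> norm z \<le> 1 \<Longrightarrow> blaschke as z = 0 \<longleftrightarrow> z \<in> set as"
  by (induction as) (auto simp: blaschke_factor_eq_0_iff)

lemma blaschke_replicate_0: "blaschke (replicate m 0) z = z ^ m"
  by (induction m) (auto simp: blaschke_factor_def)

lemma blaschke_0: "blaschke as 0 = of_real (\<Prod>a\<leftarrow>as. norm a)"
  by (induction as) (auto simp: blaschke_factor_0)

lemma blaschke_inner:
  "(\<And>a. a \<in> set as \<Longrightarrow> norm a < 1) \<Longrightarrow> on_disc (blaschke as) \<in> inner_functions"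
  by (intro disc_algebra_inner blaschke_disc_algebra norm_blaschke_circle)

lemma blaschke_remove1:
  "a \<in> set as \<Longrightarrow> blaschke as z = blaschke_factor a z * blaschke (remove1 a as) z"
  by (induction as) auto

lemma norm_one_minus_blaschke:
  assumes "\<And>a. a \<in> set as \<Longrightarrow> norm a < 1 \<and> a \<noteq> 0 \<and> d \<le> norm (z - a)" "norm z = 1" "d > 0"
  shows "norm (1 - blaschke as z) \<le> 2 / d * (\<Sum>a\<leftarrow>as. 1 - norm a)"
  using assms(1)
proof (induction as)
  case (Cons a as)
  have a: "norm a < 1" "a \<noteq> 0" "d \<le> norm (z - a)" using Cons.prems by auto
  have "norm (1 - blaschke_factor a z) \<le> 2 * (1 - norm a) / norm (z - a)"
    by (intro norm_one_minus_blaschke_factor a assms)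
  also have "\<dots> \<le> 2 * (1 - norm a) / d" using a assms by (intro divide_left_mono mult_pos_pos) auto
  finally have "norm (1 - blaschke_factor a z) \<le> 2 / d * (1 - norm a)" by simp
  moreover have "norm (blaschke_factor a z * (1 - blaschke as z)) \<le> 2 / d * (\<Sum>a\<leftarrow>as. 1 - norm a)"
    using Cons norm_blaschke_factor_circle[OF a(1) assms(2)] by (simp add: norm_mult)
  moreover have eq: "1 - blaschke (a # as) z
      = (1 - blaschke_factor a z) + blaschke_factor a z * (1 - blaschke as z)"
    by (simp add: algebra_simps)
  have "norm (1 - blaschke (a # as) z)
      \<le> norm (1 - blaschke_factor a z) + norm (blaschke_factor a z * (1 - blaschke as z))"
    unfolding eq by (rule norm_triangle_ineq)
  moreover have "2 / d * (\<Sum>a\<leftarrow>a # as. 1 - norm a) = 2 / d * (1 - norm a) + 2 / d * (\<Sum>a\<leftarrow>as. 1 - norm a)"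
    by (simp only: list.map sum_list.Cons distrib_left)
  ultimately show ?case by linarith
qed simp

text \<open>
  A Blaschke product whose value at \<open>0\<close> is close to \<open>1\<close> has zeros of small total distance to the circle.
  The inequality follows from \<open>x \<le> 1 / (1 + (1 - x))\<close> and \<open>\<Prod>(1 + t\<^sub>i) \<ge> 1 + \<Sum>t\<^sub>i\<close>.
\<close>

lemma prod_norm_sum_le:
  assumes "\<And>a. a \<in> set as \<Longrightarrow> norm (a::complex) < 1"
  shows "(\<Prod>a\<leftarrow>as. norm a) * (1 + (\<Sum>a\<leftarrow>as. 1 - norm a)) \<le> 1"
  using assms
proof (induction as)
  case (Cons a as)
  define P where "P = (\<Prod>a\<leftarrow>as. norm a)"
  define S where "S = (\<Sum>a\<leftarrow>as. 1 - norm a)"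
  define x where "x = norm a"
  have x: "0 \<le> x" "x \<le> 1" using Cons.prems[of a] by (auto simp: x_def)
  have IH: "P * (1 + S) \<le> 1" using Cons by (auto simp: P_def S_def)
  have "0 \<le> S" unfolding S_def using Cons.prems by (intro sum_list_nonneg) force
  moreover have P0: "0 \<le> P" unfolding P_def by (intro prod_list_nonneg) auto
  ultimately have "0 \<le> P * S" by simp
  then have P: "P \<le> 1" using IH by (simp add: distrib_left)
  have "P * (1 - x) \<le> 1 - x" using x P P0 mult_right_mono[of P 1 "1 - x"] by simp
  then have "P * (1 + S) + P * (1 - x) \<le> 2 - x" using IH by simp
  then have "x * (P * (1 + S) + P * (1 - x)) \<le> x * (2 - x)" using x by (intro mult_left_mono)
  also have "x * (2 - x) \<le> 1" using zero_le_power2[of "1 - x"] by (simp add: power2_eq_square algebra_simps)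
  finally show ?case by (simp add: P_def[symmetric] S_def[symmetric] x_def[symmetric] algebra_simps)
qed simp

text \<open>
  The singularity of the quotient at \<open>a\<close> is removable, and away from \<open>a\<close> the factor is bounded below.
\<close>

lemma divide_blaschke_factor:
  assumes v: "v holomorphic_on ball 0 1" and B: "\<And>z. norm z < 1 \<Longrightarrow> norm (v z) \<le> B"
    and a: "norm a < 1" and va: "v a = 0"
  shows "\<exists>w C. w holomorphic_on ball 0 1 \<and> (\<forall>z. norm z < 1 \<longrightarrow> norm (w z) \<le> C) \<and>
    (\<forall>z. norm z < 1 \<longrightarrow> v z = blaschke_factor a z * w z)"
proof -
  define w where "w z = (if z = a then deriv v a else (v z - v a) / (z - a))" for z
  have wh: "w holomorphic_on ball 0 1"
    unfolding w_def by (rule pole_lemma[OF v]) (use a in auto)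
  have w: "v z = (z - a) * w z" for z using va by (simp add: w_def)
  define R where "R = (1 + norm a) / 2"
  have R: "norm a < R" "R < 1" using a by (auto simp: R_def)
  have "bounded (w ` cball 0 R)"
  proof (intro compact_imp_bounded compact_continuous_image compact_cball)
    show "continuous_on (cball 0 R) w"
      by (rule continuous_on_subset[OF holomorphic_on_imp_continuous_on[OF wh]]) (use R in auto)
  qed
  then obtain K where K: "\<And>z. z \<in> cball 0 R \<Longrightarrow> norm (w z) \<le> K"
    unfolding bounded_iff by blast
  have bound: "norm (w z) \<le> max K (B / (R - norm a))" if z: "norm z < 1" for z
  proof (cases "norm z \<le> R")
    case True
    then show ?thesis using K[of z] by simp
  next
    case False
    then have d: "R - norm a \<le> norm (z - a)" using norm_triangle_ineq2[of z a] by linarith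
    have "norm (w z) * (R - norm a) \<le> norm (w z) * norm (z - a)" using d by (intro mult_left_mono) auto
    also have "\<dots> = norm (v z)" using w[of z] by (simp add: norm_mult mult.commute)
    finally have "norm (w z) \<le> B / (R - norm a)" using B[OF z] R by (simp add: field_simps)
    then show ?thesis by simp
  qed
  obtain M where M: "M > 0" "\<And>z. norm z \<le> 1 \<Longrightarrow> norm (blaschke_unit a z) \<le> M"
    using disc_algebra_bound[OF blaschke_unit_disc_algebra] by blast
  show ?thesis
  proof (intro exI conjI allI impI)
    show "(\<lambda>z. blaschke_unit a z * w z) holomorphic_on ball 0 1"
      using wh disc_algebra_hol[OF blaschke_unit_disc_algebra] by (rule holomorphic_on_mult[rotated])
    show "norm (blaschke_unit a z * w z) \<le> M * max K (B / (R - norm a))" if "norm z < 1" for z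
      unfolding norm_mult using M bound[OF that] that by (intro mult_mono) auto
    show "v z = blaschke_factor a z * (blaschke_unit a z * w z)" if "norm z < 1" for z
      using w[of z] blaschke_factor_unit[OF a, of z] that by (simp flip: mult.assoc)
  qed
qed

lemma inner_divide_blaschke_factor:
  assumes v: "v \<in> inner_functions" and a: "norm a < 1" and va: "v a = 0"
  shows "\<exists>w \<in> inner_functions. \<forall>z. norm z < 1 \<longrightarrow> v z = blaschke_factor a z * w z"
proof -
  obtain A where A: "\<And>z. norm (v z) \<le> A" using Hinf_bound v by (auto simp: inner_functions_def)
  obtain w C where w: "w holomorphic_on ball 0 1" "\<And>z. norm z < 1 \<Longrightarrow> norm (w z) \<le> C"
    "\<And>z. norm z < 1 \<Longrightarrow> v z = blaschke_factor a z * w z"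
    using divide_blaschke_factor[OF inner_hol[OF v] A a va] by blast
  have wH: "on_disc w \<in> Hinf" using w by (intro on_disc_Hinf)
  have "AE t in lebesgue_on {0..2 * pi}.
     \<exists>l. norm l = 1 \<and> ((\<lambda>r. v (of_real r * cis t)) \<longlongrightarrow> l) (at_left 1)"
    using v by (simp add: inner_functions_def)
  then have "AE t in lebesgue_on {0..2 * pi}.
     \<exists>l. norm l = 1 \<and> ((\<lambda>r. on_disc w (of_real r * cis t)) \<longlongrightarrow> l) (at_left 1)"
  proof (rule AE_mp, intro AE_I2 impI)
    fix t assume "\<exists>l. norm l = 1 \<and> ((\<lambda>r. v (of_real r * cis t)) \<longlongrightarrow> l) (at_left 1)"
    then obtain l where l: "norm l = 1" "((\<lambda>r. v (of_real r * cis t)) \<longlongrightarrow> l) (at_left 1)" by blast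
    define m where "m = blaschke_factor a (cis t)"
    have m: "norm m = 1" unfolding m_def by (intro norm_blaschke_factor_circle a) simp
    have bl: "((\<lambda>r. blaschke_factor a (of_real r * cis t)) \<longlongrightarrow> m) (at_left 1)"
      unfolding m_def by (intro disc_algebra_radial_limit blaschke_factor_disc_algebra a)
    have m0: "m \<noteq> 0" using m by auto
    have "((\<lambda>r. v (of_real r * cis t) / blaschke_factor a (of_real r * cis t)) \<longlongrightarrow> l / m) (at_left 1)"
      by (intro tendsto_divide l bl m0)
    moreover have "\<forall>\<^sub>F r in at_left 1. v (of_real r * cis t) / blaschke_factor a (of_real r * cis t)
        = on_disc w (of_real r * cis t)"
      using eventually_at_left_1_disc[of t] tendsto_imp_eventually_ne[OF bl m0]
      by eventually_elim (simp add: on_disc_in w(3))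
    ultimately have "((\<lambda>r. on_disc w (of_real r * cis t)) \<longlongrightarrow> l / m) (at_left 1)"
      by (rule Lim_transform_eventually)
    then show "\<exists>l. norm l = 1 \<and> ((\<lambda>r. on_disc w (of_real r * cis t)) \<longlongrightarrow> l) (at_left 1)"
      using l m by (intro exI[of _ "l / m"]) (simp add: norm_divide)
  qed
  then have "on_disc w \<in> inner_functions" using wH by (simp add: inner_functions_def)
  then show ?thesis using w(3) by (intro bexI[of _ "on_disc w"]) (auto simp: on_disc_in)
qed

text \<open>
  A zero would split off a Blaschke factor, an inner factor of modulus less than \<open>1\<close> at \<open>0\<close>.
\<close>

lemma cyclic_nonzero:
  assumes V: "cyclic V" and h: "V holomorphic_on ball 0 1" and B: "\<And>z. norm z < 1 \<Longrightarrow> norm (V z) \<le> B"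
    and z: "norm z < 1"
  shows "V z \<noteq> 0"
proof
  assume 0: "V z = 0"
  obtain w C where w: "w holomorphic_on ball 0 1" "\<And>x. norm x < 1 \<Longrightarrow> norm (w x) \<le> C"
    "\<And>x. norm x < 1 \<Longrightarrow> V x = blaschke_factor z x * w x"
    using divide_blaschke_factor[OF h B z 0] by blast
  have "on_disc (blaschke_factor z) \<in> inner_functions"
    by (intro disc_algebra_inner blaschke_factor_disc_algebra norm_blaschke_factor_circle z)
  from cyclic_inner_factor[OF V this w(1), of C] have "1 \<le> norm (on_disc (blaschke_factor z) 0)"
    using w by (simp add: on_disc_in)
  then show False using z by (simp add: on_disc_in blaschke_factor_0)
qed

section \<open>Factorization of functions analytic on the closed disc\<close>

lemma cyclic_disc_algebra_nonzero:
  assumes F: "disc_algebra F" "cyclic F" and z: "norm z < 1"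
  shows "F z \<noteq> 0"
proof -
  obtain B where "\<And>z. norm z \<le> 1 \<Longrightarrow> norm (F z) \<le> B" using disc_algebra_bound[OF F(1)] by blast
  then show ?thesis by (intro cyclic_nonzero[OF F(2) disc_algebra_hol[OF F(1)] _ z, of B]) auto
qed

lemma cyclic_mult:
  assumes F: "disc_algebra F" "cyclic F" and G: "disc_algebra G" "cyclic G"
  shows "cyclic (\<lambda>z. F z * G z)"
  unfolding cyclic_def
proof (intro allI impI)
  fix e :: real assume e: "e > 0"
  obtain p where p: "\<And>r. r \<in> {0..<1} \<Longrightarrow> mean2 (\<lambda>z. poly p z * F z - 1) r \<le> e / 2"
    using cyclicD[OF F(2), of "e / 2"] e by (meson half_gt_zero)
  have pF: "disc_algebra (\<lambda>z. poly p z * F z)" by (intro disc_algebra_intros F)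
  obtain M where M: "M > 0" "\<And>z. norm z \<le> 1 \<Longrightarrow> norm (poly p z * F z) \<le> M"
    using disc_algebra_bound[OF pF] by blast
  obtain q where q: "\<And>r. r \<in> {0..<1} \<Longrightarrow> mean2 (\<lambda>z. poly q z * G z - 1) r \<le> e / (2 * M)"
    using cyclicD[OF G(2), of "e / (2 * M)"] e M by (meson divide_pos_pos mult_pos_pos zero_less_numeral)
  have "mean2 (\<lambda>z. poly (p * q) z * (F z * G z) - 1) r \<le> e" if r: "r \<in> {0..<1}" for r
  proof -
    \<comment> \<open>\<open>q\<close> is chosen after \<open>p\<close>, so the error in \<open>q G\<close> may be weighted by the supremum of \<open>p F\<close>\<close>
    have "mean2 (\<lambda>z. poly (p * q) z * (F z * G z) - 1) r
        = mean2 (\<lambda>z. (poly p z * F z) * (poly q z * G z - 1) + (poly p z * F z - 1)) r"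
      by (simp add: algebra_simps)
    also have "\<dots> \<le> mean2 (\<lambda>z. (poly p z * F z) * (poly q z * G z - 1)) r + mean2 (\<lambda>z. poly p z * F z - 1) r"
      by (intro mean2_add_le holomorphic_intros disc_algebra_hol F G r)
    also have "mean2 (\<lambda>z. (poly p z * F z) * (poly q z * G z - 1)) r \<le> M * mean2 (\<lambda>z. poly q z * G z - 1) r"
      by (intro mean2_mult_le holomorphic_intros disc_algebra_hol F G r M) simp
    also have "\<dots> \<le> M * (e / (2 * M))" using q[OF r] M by (intro mult_left_mono) auto
    finally show ?thesis using p[OF r] M by simp
  qed
  then show "\<exists>p. \<forall>r\<in>{0..<1}. mean2 (\<lambda>z. poly p z * (F z * G z) - 1) r \<le> e" by blast
qed

text \<open>
  Here \<open>1/G\<close> is bounded, and a polynomial close to it in \<open>H\<^sup>2\<close> does the job.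
\<close>

lemma cyclic_nonvanishing:
  assumes G: "disc_algebra G" and nz: "\<And>z. norm z \<le> 1 \<Longrightarrow> G z \<noteq> 0"
  shows "cyclic G"
  unfolding cyclic_def
proof (intro allI impI)
  fix e :: real assume e: "e > 0"
  have G': "disc_algebra (\<lambda>z. 1 / G z)" by (intro disc_algebra_intros G nz)
  obtain B where B: "\<And>z. norm z \<le> 1 \<Longrightarrow> norm (1 / G z) \<le> B"
    using disc_algebra_bound[OF G'] by blast
  obtain M where M: "M > 0" "\<And>z. norm z \<le> 1 \<Longrightarrow> norm (G z) \<le> M"
    using disc_algebra_bound[OF G] by blast
  have "mean2 (\<lambda>z. 1 / G z) r \<le> B" if "r \<in> {0..<1}" for r
    using that B by (intro mean2_le_sup disc_algebra_hol G') auto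
  moreover have "e / M > 0" using e M by simp
  ultimately obtain p where p: "\<And>r. r \<in> {0..<1} \<Longrightarrow> mean2 (\<lambda>z. 1 / G z - poly p z) r \<le> e / M"
    using poly_dense_H2[OF disc_algebra_hol[OF G']] by meson
  have "mean2 (\<lambda>z. poly p z * G z - 1) r \<le> e" if r: "r \<in> {0..<1}" for r
  proof -
    have "mean2 (\<lambda>z. poly p z * G z - 1) r = mean2 (\<lambda>z. G z * (poly p z - 1 / G z)) r"
      using r nz by (intro mean2_cong) (auto simp: field_simps)
    also have "\<dots> \<le> M * mean2 (\<lambda>z. poly p z - 1 / G z) r"
      by (intro mean2_mult_le holomorphic_intros disc_algebra_hol G G' r M nz) auto
    also have "mean2 (\<lambda>z. poly p z - 1 / G z) r = mean2 (\<lambda>z. 1 / G z - poly p z) r"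
      by (subst mean2_minus) simp
    also have "M * \<dots> \<le> M * (e / M)" using p[OF r] M by (intro mult_left_mono) auto
    finally show ?thesis using M by simp
  qed
  then show "\<exists>p. \<forall>r\<in>{0..<1}. mean2 (\<lambda>z. poly p z * G z - 1) r \<le> e" by blast
qed

text \<open>
  The partial sums \<open>s\<^sub>j\<close> of the geometric series satisfy \<open>s\<^sub>j(z) (1 - c z) = 1 - (c z)\<^sup>j\<close>. When \<open>\<bar>c\<bar> = 1\<close> the
  error does not get small, but the errors for different \<open>j\<close> are orthogonal, so that the average of
  \<open>s\<^sub>1, \<dots>, s\<^sub>N\<close> has an error of size at most \<open>1/\<surd>N\<close>. This covers zeros on the circle.
\<close>

lemma cyclic_one_minus_mult:
  assumes c: "norm c \<le> 1"
  shows "cyclic (\<lambda>z. 1 - c * z)"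
  unfolding cyclic_def
proof (intro allI impI)
  fix e :: real assume e: "e > 0"
  obtain N :: nat where N: "inverse (e\<^sup>2) < N" using reals_Archimedean2 by blast
  have N0: "N > 0" using N e by (intro gr0I) (auto simp: not_less)
  define p where "p = (\<Sum>j\<in>{1..N}. \<Sum>k<j. monom (c ^ k / of_nat N) k)"
  define d where "d j = - (c ^ j) / of_nat N" for j
  have p: "poly p z * (1 - c * z) - 1 = (\<Sum>j\<in>{1..N}. d j * z ^ j)" for z
  proof -
    have "poly p z * (1 - c * z) = (\<Sum>j\<in>{1..N}. (1 - c * z) * (\<Sum>k<j. (c * z) ^ k)) / of_nat N"
      by (simp add: p_def poly_sum poly_monom power_mult_distrib sum_distrib_right sum_distrib_left
          sum_divide_distrib mult_ac)
    also have "\<dots> = (\<Sum>j\<in>{1..N}. 1 - (c * z) ^ j) / of_nat N"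
      by (simp only: one_diff_power_eq)
    also have "\<dots> = 1 + (\<Sum>j\<in>{1..N}. d j * z ^ j)"
      using N0 by (simp add: sum_subtractf diff_divide_distrib sum_divide_distrib d_def
          power_mult_distrib sum_negf)
    finally show ?thesis by simp
  qed
  have "mean2 (\<lambda>z. poly p z * (1 - c * z) - 1) r \<le> e" if r: "r \<in> {0..<1}" for r
  proof -
    have "(mean2 (\<lambda>z. poly p z * (1 - c * z) - 1) r)\<^sup>2 = (\<Sum>j\<in>{1..N}. (norm (d j))\<^sup>2 * r ^ (2 * j))"
      unfolding p by (rule mean2_sum_powers) (use r in auto)
    also have "\<dots> \<le> (\<Sum>j\<in>{1..N}. (1 / N)\<^sup>2 * 1)"
    proof (rule sum_mono, rule mult_mono)
      fix j
      have "norm c ^ j \<le> 1" using c by (simp add: power_le_one)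
      then show "(norm (d j))\<^sup>2 \<le> (1 / N)\<^sup>2"
        by (intro power_mono) (auto simp: d_def norm_divide norm_power divide_right_mono)
      show "r ^ (2 * j) \<le> 1" using r by (intro power_le_one) auto
    qed (use r in auto)
    also have "\<dots> = 1 / N" using N0 by (simp add: power2_eq_square field_simps)
    also have "\<dots> \<le> e\<^sup>2" using N N0 e by (simp add: field_simps)
    finally show ?thesis by (rule power2_le_imp_le) (use e in simp)
  qed
  then show "\<exists>p. \<forall>r\<in>{0..<1}. mean2 (\<lambda>z. poly p z * (1 - c * z) - 1) r \<le> e" by blast
qed

lemma cyclic_blaschke_unit:
  assumes "norm a \<le> 1"
  shows "cyclic (blaschke_unit a)"
proof (cases "a = 0")
  case True
  have "cyclic (\<lambda>z. 1)" by (intro cyclic_nonvanishing disc_algebra_intros) auto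
  then show ?thesis using True by (simp add: blaschke_unit_def [abs_def])
next
  case False
  have "cyclic (\<lambda>z. - sgn a)" using False by (intro cyclic_nonvanishing disc_algebra_intros) (auto simp: sgn_eq_0_iff)
  then have "cyclic (\<lambda>z. - sgn a * (1 - cnj a * z))"
    using assms by (intro cyclic_mult cyclic_one_minus_mult disc_algebra_intros) auto
  then show ?thesis using False by (simp add: blaschke_unit_def [abs_def])
qed

lemma blaschke_unit_circle:
  assumes "norm a = 1"
  shows "blaschke_unit a z = z - a"
proof -
  have "a * cnj a = 1" using assms complex_norm_square[of a] by simp
  moreover have "sgn a = a" using assms by (simp add: sgn_eq)
  ultimately show ?thesis using assms by (auto simp: blaschke_unit_def algebra_simps simp flip: mult.assoc)
qed

text \<open>
  For zeros in the open disc and an outer factor that is continuous up to the circle this is the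
  inner-outer factorization of \<open>f\<close>; the normalization of the inner factor is built into the Blaschke product.
\<close>

definition blaschke_outer_factorization where
  "blaschke_outer_factorization f as F \<longleftrightarrow>
     (\<forall>a\<in>set as. norm a < 1) \<and> disc_algebra F \<and> cyclic F \<and> (\<forall>z. norm z < 1 \<longrightarrow> f z = blaschke as z * F z)"

text \<open>
  By induction on the number of distinct zeros in the closed disc, which is finite by compactness; a
  zero is removed together with its multiplicity.
\<close>

lemma factor_zeros:
  assumes "g holomorphic_on ball 0 R" "R > 1" "\<exists>z\<in>ball 0 1. g z \<noteq> 0"
  shows "\<exists>zs G. set zs \<subseteq> cball 0 1 \<and> disc_algebra G \<and> (\<forall>z. norm z \<le> 1 \<longrightarrow> G z \<noteq> 0) \<and>
    (\<forall>z. norm z \<le> 1 \<longrightarrow> g z = (\<Prod>a\<leftarrow>zs. z - a) * G z)"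
  using assms(1,3)
proof (induction "card {z\<in>cball 0 1. g z = 0}" arbitrary: g rule: less_induct)
  case less
  have sub: "cball 0 1 \<subseteq> ball (0::complex) R" using assms(2) by auto
  show ?case
  proof (cases "\<exists>a\<in>cball 0 1. g a = 0")
    case False
    have "disc_algebra g"
      unfolding disc_algebra_def
      using holomorphic_on_subset[OF less.prems(1) subset_ball[of 1 R]]
        continuous_on_subset[OF holomorphic_on_imp_continuous_on[OF less.prems(1)] sub] assms(2) by auto
    then show ?thesis using False by (intro exI[of _ "[]"] exI[of _ g]) auto
  next
    case True
    then obtain a where a: "norm a \<le> 1" "g a = 0" by auto
    obtain z0 where z0: "norm z0 < 1" "g z0 \<noteq> 0" using less.prems(2) by auto
    have aR: "a \<in> ball 0 R" using a assms(2) by auto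
    have nc: "\<not> g constant_on ball 0 R"
    proof
      assume "g constant_on ball 0 R"
      then obtain y where y: "\<And>x. x \<in> ball 0 R \<Longrightarrow> g x = y" unfolding constant_on_def by blast
      have "g a = y" "g z0 = y" using y aR z0 assms(2) by auto
      then show False using a z0 by simp
    qed
    obtain h0 r n where h0: "0 < n" "0 < r" "ball a r \<subseteq> ball 0 R" "h0 holomorphic_on ball a r"
      "\<And>w. w \<in> ball a r \<Longrightarrow> g w = (w - a) ^ n * h0 w" "\<And>w. w \<in> ball a r \<Longrightarrow> h0 w \<noteq> 0"
      using holomorphic_factor_zero_nonconstant[OF less.prems(1) open_ball connected_ball aR a(2) nc] by metis
    define h where "h w = (if w = a then h0 a else g w / (w - a) ^ n)" for w
    have h_h0: "h w = h0 w" if "w \<in> ball a r" for w using h0(5)[OF that] by (auto simp: h_def)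
    have "h holomorphic_on ball a r" using h0(4) by (rule holomorphic_transform) (simp add: h_h0)
    moreover have "h holomorphic_on (ball 0 R - {a})"
    proof (rule holomorphic_transform)
      show "(\<lambda>w. g w / (w - a) ^ n) holomorphic_on ball 0 R - {a}"
        by (intro holomorphic_intros holomorphic_on_subset[OF less.prems(1)]) auto
    qed (auto simp: h_def)
    ultimately have "h holomorphic_on (ball a r \<union> (ball 0 R - {a}))"
      by (intro holomorphic_on_Un) auto
    moreover have "ball a r \<union> (ball 0 R - {a}) = ball 0 R" using h0(2,3) by auto
    ultimately have hh: "h holomorphic_on ball 0 R" by simp
    have g_h: "g w = (w - a) ^ n * h w" for w using a h0(1) by (simp add: h_def)
    have ha: "h a \<noteq> 0" using h0(2) h0(6)[of a] by (simp add: h_def)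
    have zeros: "{z\<in>cball 0 1. h z = 0} = {z\<in>cball 0 1. g z = 0} - {a}"
      using ha h0(1) by (auto simp: g_h)
    have "finite {z\<in>cball 0 1. g z = 0}"
      by (rule holomorphic_compact_finite_zeros[OF less.prems(1) _ _ _ sub nc]) auto
    then have "card {z\<in>cball 0 1. h z = 0} < card {z\<in>cball 0 1. g z = 0}"
      unfolding zeros using a by (intro card_Diff1_less) auto
    moreover have "\<exists>z\<in>ball 0 1. h z \<noteq> 0" using z0 by (intro bexI[of _ z0]) (auto simp: g_h)
    ultimately obtain zs G where IH: "set zs \<subseteq> cball 0 1" "disc_algebra G"
      "\<And>z. norm z \<le> 1 \<Longrightarrow> G z \<noteq> 0" "\<And>z. norm z \<le> 1 \<Longrightarrow> h z = (\<Prod>a\<leftarrow>zs. z - a) * G z"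
      using less.hyps[OF _ hh] by blast
    show ?thesis
    proof (intro exI conjI allI impI)
      show "set (replicate n a @ zs) \<subseteq> cball 0 1" using IH(1) a by auto
      show "g z = (\<Prod>a\<leftarrow>replicate n a @ zs. z - a) * G z" if "norm z \<le> 1" for z
        using IH(4)[OF that] by (simp add: g_h prod_list_replicate)
    qed (use IH in auto)
  qed
qed

text \<open>
  A factor \<open>z - b\<close> goes to the outer part entirely when \<open>\<bar>b\<bar> = 1\<close>, and otherwise splits into a Blaschke
  factor and a polynomial of degree at most \<open>1\<close> without zeros in the closed disc.
\<close>

lemma split_zeros:
  assumes "set zs \<subseteq> cball 0 1" and G: "disc_algebra G" "\<And>z. norm z \<le> 1 \<Longrightarrow> G z \<noteq> 0"
  shows "\<exists>as F. blaschke_outer_factorization (\<lambda>z. (\<Prod>a\<leftarrow>zs. z - a) * G z) as F"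
  using assms(1)
proof (induction zs)
  case Nil
  have "blaschke_outer_factorization (\<lambda>z. (\<Prod>a\<leftarrow>[]. z - a) * G z) [] G"
    using G cyclic_nonvanishing[of G] by (simp add: blaschke_outer_factorization_def)
  then show ?case by blast
next
  case (Cons b zs)
  obtain as F where IH: "\<And>a. a \<in> set as \<Longrightarrow> norm a < 1" "disc_algebra F" "cyclic F"
    "\<And>z. norm z < 1 \<Longrightarrow> (\<Prod>a\<leftarrow>zs. z - a) * G z = blaschke as z * F z"
    using Cons by (auto simp: blaschke_outer_factorization_def)
  have b: "norm b \<le> 1" using Cons.prems by auto
  have F': "disc_algebra (\<lambda>z. blaschke_unit b z * F z)" "cyclic (\<lambda>z. blaschke_unit b z * F z)"
    by (intro cyclic_mult disc_algebra_intros blaschke_unit_disc_algebra cyclic_blaschke_unit IH b)+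
  show ?case
  proof (cases "norm b = 1")
    case True
    have "blaschke_outer_factorization (\<lambda>z. (\<Prod>a\<leftarrow>b # zs. z - a) * G z) as (\<lambda>z. blaschke_unit b z * F z)"
      unfolding blaschke_outer_factorization_def using F' IH
      by (auto simp: blaschke_unit_circle[OF True] mult.left_commute mult.assoc)
    then show ?thesis by blast
  next
    case False
    then have b1: "norm b < 1" using b by simp
    have "blaschke_outer_factorization (\<lambda>z. (\<Prod>a\<leftarrow>b # zs. z - a) * G z) (b # as) (\<lambda>z. blaschke_unit b z * F z)"
      unfolding blaschke_outer_factorization_def
    proof (intro conjI allI impI F')
      fix z :: complex assume z: "norm z < 1"
      have "z - b = blaschke_factor b z * blaschke_unit b z"
        using blaschke_factor_unit[OF b1, of z] z by simp
      then show "(\<Prod>a\<leftarrow>b # zs. z - a) * G z = blaschke (b # as) z * (blaschke_unit b z * F z)"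
        using IH(4)[OF z] by (simp add: mult_ac)
    qed (use IH b1 in auto)
    then show ?thesis by blast
  qed
qed

lemma exists_blaschke_outer_factorization:
  assumes f: "f \<in> Hol_closed_disc" "f \<noteq> (\<lambda>z. 0)"
  shows "\<exists>as F. blaschke_outer_factorization f as F"
proof -
  obtain U g where g: "open U" "cball 0 1 \<subseteq> U" "g holomorphic_on U" "\<And>z. z \<in> ball 0 1 \<Longrightarrow> f z = g z"
    using f by (auto simp: Hol_closed_disc_def)
  obtain e where e: "e > 0" "(\<Union>x\<in>cball 0 1. ball x e) \<subseteq> U"
    using compact_subset_open_imp_ball_epsilon_subset[OF compact_cball g(1,2)] by blast
  have "ball 0 (1 + e) \<subseteq> U"
  proof
    fix z :: complex assume z: "z \<in> ball 0 (1 + e)"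
    show "z \<in> U"
    proof (cases "norm z \<le> 1")
      case True
      then show ?thesis using g(2) by auto
    next
      case False
      then have n: "norm z > 1" by simp
      have "z \<noteq> 0" using n by auto
      then have "z = norm z *\<^sub>R sgn z" by (simp add: sgn_div_norm)
      then have "sgn z - z = (1 - norm z) *\<^sub>R sgn z" by (metis scaleR_left_diff_distrib scaleR_one)
      then have "dist (sgn z) z = norm ((1 - norm z) *\<^sub>R sgn z)" by (simp only: dist_norm)
      also have "\<dots> < e" using n z by (simp add: norm_sgn)
      finally have "z \<in> ball (sgn z) e" by simp
      moreover have "sgn z \<in> cball 0 1" using n by (simp add: norm_sgn)
      ultimately show ?thesis using e(2) by blast
    qed
  qed
  then have gR: "g holomorphic_on ball 0 (1 + e)" using g(3) holomorphic_on_subset by blast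
  have off: "f z = 0" if "z \<notin> ball 0 1" for z
    using f(1) that by (auto simp: Hol_closed_disc_def Hinf_def Hol_disc_def)
  obtain z0 where z0: "f z0 \<noteq> 0" using f(2) by (auto simp: fun_eq_iff)
  then have "z0 \<in> ball 0 1" using off by blast
  then have "\<exists>z\<in>ball 0 1. g z \<noteq> 0" using z0 g(4) by (intro bexI[of _ z0]) auto
  then obtain zs G where zs: "set zs \<subseteq> cball 0 1" "disc_algebra G" "\<And>z. norm z \<le> 1 \<Longrightarrow> G z \<noteq> 0"
    "\<And>z. norm z \<le> 1 \<Longrightarrow> g z = (\<Prod>a\<leftarrow>zs. z - a) * G z"
    using factor_zeros[OF gR] e(1) by auto
  obtain as F where "blaschke_outer_factorization (\<lambda>z. (\<Prod>a\<leftarrow>zs. z - a) * G z) as F"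
    using split_zeros[OF zs(1-3)] by blast
  then have "blaschke_outer_factorization f as F"
    using g(4) zs(4) by (auto simp: blaschke_outer_factorization_def)
  then show ?thesis by blast
qed

lemma blaschke_outer_factorizationD:
  assumes "blaschke_outer_factorization f as F"
  shows "\<And>a. a \<in> set as \<Longrightarrow> norm a < 1" "disc_algebra F" "cyclic F"
    "\<And>z. norm z < 1 \<Longrightarrow> f z = blaschke as z * F z" "\<And>z. norm z < 1 \<Longrightarrow> F z \<noteq> 0"
proof -
  show *: "\<And>a. a \<in> set as \<Longrightarrow> norm a < 1" "disc_algebra F" "cyclic F"
    "\<And>z. norm z < 1 \<Longrightarrow> f z = blaschke as z * F z"
    using assms by (auto simp: blaschke_outer_factorization_def)
  show "F z \<noteq> 0" if "norm z < 1" for z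
    by (rule cyclic_disc_algebra_nonzero[OF *(2,3) that])
qed

section \<open>Uniqueness and the values of the factorization maps\<close>

text \<open>
  Induction on the zeros of the Blaschke product. A zero \<open>a\<close> must be a zero of \<open>v\<close> because the outer
  function \<open>V\<close> has none, so the Blaschke factor at \<open>a\<close> cancels. Once no zero is left, \<open>v\<close> is an inner
  factor of the outer function \<open>F\<close>, hence constant.
\<close>

lemma inner_outer_unique_up_to_constant:
  assumes as: "\<And>a. a \<in> set as \<Longrightarrow> norm a < 1" and F: "disc_algebra F" "cyclic F"
    and v: "v \<in> inner_functions"
    and V: "V holomorphic_on ball 0 1" "\<And>z. norm z < 1 \<Longrightarrow> norm (V z) \<le> B" "cyclic V"
    and eq: "\<And>z. norm z < 1 \<Longrightarrow> blaschke as z * F z = v z * V z"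
  shows "\<exists>c. norm c = 1 \<and> (\<forall>z. norm z < 1 \<longrightarrow> v z = c * blaschke as z \<and> F z = c * V z)"
  using as v eq
proof (induction as arbitrary: v)
  case Nil
  have "1 \<le> norm (v 0)"
    by (rule cyclic_inner_factor[OF F(2) Nil.prems(2) V(1,2)]) (use Nil.prems(3) in auto)
  note c = inner_constant[OF Nil.prems(2) this]
  show ?case
  proof (intro exI[of _ "v 0"] conjI allI impI)
    fix z :: complex assume z: "norm z < 1"
    show "v z = v 0 * blaschke [] z" using c(2)[OF z] by simp
    show "F z = v 0 * V z" using Nil.prems(3)[OF z] c(2)[OF z] by simp
  qed (rule c(1))
next
  case (Cons a as)
  have a: "norm a < 1" using Cons.prems by simp
  have "v a * V a = 0" using Cons.prems(3)[OF a] blaschke_factor_eq_0_iff[of a a] a by simp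
  then have "v a = 0" using cyclic_nonzero[OF V(3,1,2) a] by auto
  then obtain w where w: "w \<in> inner_functions" "\<And>z. norm z < 1 \<Longrightarrow> v z = blaschke_factor a z * w z"
    using inner_divide_blaschke_factor[OF Cons.prems(2) a] by blast
  have "blaschke as z * F z = w z * V z" if z: "norm z < 1" for z
  proof (rule analytic_continuation_open[of "ball 0 1 - {a}" "ball 0 1" "\<lambda>z. blaschke as z * F z" "\<lambda>z. w z * V z"])
    show "ball 0 1 - {a} \<noteq> {}"
    proof
      assume "ball 0 1 - {a} = {}"
      moreover have "{0, 1/2} \<subseteq> ball (0::complex) 1" by auto
      ultimately have "{0, 1/2} \<subseteq> {a}" by blast
      then show False by auto
    qed
    show "(\<lambda>z. blaschke as z * F z) holomorphic_on ball 0 1"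
      using Cons.prems(1) by (intro disc_algebra_hol disc_algebra_intros blaschke_disc_algebra F) auto
    show "(\<lambda>z. w z * V z) holomorphic_on ball 0 1"
      by (intro holomorphic_on_mult inner_hol w V)
    show "blaschke as x * F x = w x * V x" if "x \<in> ball 0 1 - {a}" for x
      using Cons.prems(3)[of x] w(2)[of x] blaschke_factor_eq_0_iff[OF a, of x] that by auto
  qed (use z in auto)
  then obtain c where "norm c = 1" "\<And>z. norm z < 1 \<Longrightarrow> w z = c * blaschke as z \<and> F z = c * V z"
    using Cons.IH[of w] Cons.prems(1) w(1) by auto
  then show ?case using w(2) by (intro exI[of _ c]) auto
qed

lemma derivs_at_0_power_mult:
  assumes w: "w holomorphic_on ball 0 1" and f: "\<And>z. norm z < 1 \<Longrightarrow> f z = z ^ m * w z"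
  shows "k < m \<Longrightarrow> (deriv ^^ k) f 0 = 0" "(deriv ^^ m) f 0 = fact m * w 0"
proof -
  have pw: "(deriv ^^ i) (\<lambda>z. z ^ m) 0 = (if i = m then fact m else (0::complex))" for i
  proof -
    have "(deriv ^^ i) (\<lambda>z. z ^ m) (0::complex) = pochhammer (of_nat (Suc m - i)) i * 0 ^ (m - i)"
      using higher_deriv_power[of i 0 m "0::complex"] by simp
    moreover have "pochhammer (0::complex) i = 0" if "i > m" using that by (simp add: pochhammer_0_left)
    ultimately show ?thesis by (cases i m rule: linorder_cases) (auto simp: pochhammer_fact)
  qed
  have d: "(deriv ^^ k) f 0 = (\<Sum>i = 0..k. of_nat (k choose i) * (if i = m then fact m else 0) * (deriv ^^ (k - i)) w 0)" for k
  proof -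
    have zm: "(\<lambda>z. z ^ m) holomorphic_on ball (0::complex) 1" by (intro holomorphic_intros)
    have "(deriv ^^ k) f 0 = (deriv ^^ k) (\<lambda>z. z ^ m * w z) 0"
    proof (rule higher_deriv_transform_within_open[of _ "ball 0 1"])
      show "f holomorphic_on ball 0 1"
        using holomorphic_on_mult[OF zm w] by (rule holomorphic_transform) (simp add: f)
    qed (auto simp: f intro!: holomorphic_intros w)
    also have "\<dots> = (\<Sum>i = 0..k. of_nat (k choose i) * (deriv ^^ i) (\<lambda>z. z ^ m) 0 * (deriv ^^ (k - i)) w 0)"
      by (rule higher_deriv_mult[OF zm w]) auto
    finally show ?thesis by (simp only: pw)
  qed
  show "(deriv ^^ k) f 0 = 0" if "k < m" unfolding d using that by (intro sum.neutral) auto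
  have "(deriv ^^ m) f 0 = (\<Sum>i = 0..m. if i = m then fact m * w 0 else 0)"
    unfolding d by (intro sum.cong) auto
  then show "(deriv ^^ m) f 0 = fact m * w 0" by simp
qed

lemma Mul0_power_mult:
  assumes w: "w holomorphic_on ball 0 1" and f: "\<And>z. norm z < 1 \<Longrightarrow> f z = z ^ m * w z" and w0: "w 0 \<noteq> 0"
  shows "Mul0 f = m"
proof -
  have "(deriv ^^ m) f 0 \<noteq> 0" using derivs_at_0_power_mult(2)[OF w f] w0 by simp
  moreover have "m \<le> k" if "(deriv ^^ k) f 0 \<noteq> 0" for k
    using derivs_at_0_power_mult(1)[OF w f, of k] that by force
  ultimately show ?thesis unfolding Mul0_def by (intro cInf_eq_minimum) auto
qed

lemma blaschke_power_split:
  "blaschke as z = z ^ count_list as 0 * blaschke (filter (\<lambda>a. a \<noteq> 0) as) z"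
  by (induction as) (auto simp: blaschke_factor_def mult_ac)

lemma blaschke_nonzeros_at_0:
  "\<exists>x>0. blaschke (filter (\<lambda>a. a \<noteq> 0) as) 0 = of_real x"
  by (intro exI[of _ "\<Prod>a\<leftarrow>filter (\<lambda>a. a \<noteq> 0) as. norm a"] conjI blaschke_0)
     (induction as, auto)

text \<open>
  Two normalized inner functions that differ by a unimodular constant agree, as their leading Taylor
  coefficients at \<open>0\<close> are both positive. This turns the uniqueness up to constants into uniqueness.
\<close>

lemma Q_values:
  assumes bo: "blaschke_outer_factorization f as F" and f: "f \<in> Hol_disc"
  shows "Q_inn f = on_disc (blaschke as)" "Q_out f = on_disc F" "Mul0 f = count_list as 0"
    "on_disc (blaschke as) \<in> inner_functions" "on_disc F \<in> outer_functions"
proof -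
  note bo = blaschke_outer_factorizationD[OF bo]
  define m where "m = count_list as 0"
  define bs where "bs = filter (\<lambda>a. a \<noteq> 0) as"
  have bs: "\<And>a. a \<in> set bs \<Longrightarrow> norm a < 1" using bo(1) by (auto simp: bs_def)
  have b_split: "blaschke as z = z ^ m * blaschke bs z" for z
    unfolding m_def bs_def by (rule blaschke_power_split)
  obtain P where P: "P > 0" "blaschke bs 0 = of_real P"
    using blaschke_nonzeros_at_0[of as] by (auto simp: bs_def)
  have bsh: "blaschke bs holomorphic_on ball 0 1"
    by (intro disc_algebra_hol blaschke_disc_algebra bs)
  show "Mul0 f = count_list as 0" unfolding m_def[symmetric]
  proof (rule Mul0_power_mult)
    show "(\<lambda>z. blaschke bs z * F z) holomorphic_on ball 0 1"
      by (intro holomorphic_on_mult bsh disc_algebra_hol bo)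
    show "f z = z ^ m * (blaschke bs z * F z)" if "norm z < 1" for z
      using bo(4)[OF that] by (simp add: b_split)
    show "blaschke bs 0 * F 0 \<noteq> 0" using P bo(5)[of 0] by simp
  qed
  show inn: "on_disc (blaschke as) \<in> inner_functions" by (intro blaschke_inner bo)
  obtain B where B: "\<And>z. norm z \<le> 1 \<Longrightarrow> norm (F z) \<le> B" using disc_algebra_bound[OF bo(2)] by blast
  show out: "on_disc F \<in> outer_functions"
    using B by (intro cyclic_imp_outer[of _ B] disc_algebra_hol bo) auto
  have m_eq: "Mul0 u = m" "(deriv ^^ m) u 0 = fact m * (c * of_real P)"
    if "c \<noteq> 0" "\<And>z. norm z < 1 \<Longrightarrow> u z = c * blaschke as z" for u c
  proof -
    have h: "(\<lambda>z. c * blaschke bs z) holomorphic_on ball 0 1" by (intro holomorphic_intros bsh)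
    have u: "u z = z ^ m * (c * blaschke bs z)" if "norm z < 1" for z
      using \<open>\<And>z. norm z < 1 \<Longrightarrow> u z = c * blaschke as z\<close>[OF that] by (simp add: b_split)
    show "Mul0 u = m" by (rule Mul0_power_mult[OF h u]) (use P that in auto)
    show "(deriv ^^ m) u 0 = fact m * (c * of_real P)"
      using derivs_at_0_power_mult(2)[OF h u] P(2) by simp
  qed
  have norm_b: "normalized (on_disc (blaschke as))"
    using m_eq[of 1 "on_disc (blaschke as)"] P(1)
    by (auto simp: normalized_def on_disc_in intro!: exI[of _ "fact m * P"])
  have off: "f z = 0" if "\<not> norm z < 1" for z using f that by (auto simp: Hol_disc_def)
  have fact: "is_inner_outer_factorization f (on_disc (blaschke as)) (on_disc F)"
    unfolding is_inner_outer_factorization_def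
  proof (intro conjI inn out norm_b ext)
    show "f z = on_disc (blaschke as) z * on_disc F z" for z
      using bo(4)[of z] off[of z] by (cases "norm z < 1") (auto simp: on_disc_def)
  qed
  have uniq: "v = on_disc (blaschke as) \<and> V = on_disc F" if vV: "is_inner_outer_factorization f v V" for v V
  proof -
    have v: "v \<in> inner_functions" "normalized v" and V: "V \<in> outer_functions"
      and eq: "\<And>z. f z = v z * V z"
      using vV by (auto simp: is_inner_outer_factorization_def)
    have VH: "V \<in> Hinf" using V by (simp add: outer_functions_def)
    then obtain K where K: "\<And>z. norm (V z) \<le> K" using Hinf_bound by blast
    have Vh: "V holomorphic_on ball 0 1" using VH by (simp add: Hinf_def Hol_disc_def)
    obtain c where c: "norm c = 1" "\<And>z. norm z < 1 \<Longrightarrow> v z = c * blaschke as z"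
      "\<And>z. norm z < 1 \<Longrightarrow> F z = c * V z"
      using inner_outer_unique_up_to_constant[OF bo(1-3) v(1) Vh K outer_imp_cyclic[OF V]] bo(4) eq
      by metis
    have c0: "c \<noteq> 0" using c(1) by auto
    obtain x where x: "x > 0" "(deriv ^^ Mul0 v) v 0 = of_real x" using v(2) by (auto simp: normalized_def)
    have "fact m * (c * of_real P) = of_real x" using x(2) m_eq[OF c0 c(2)] by simp
    then have "c = of_real (x / (fact m * P))" using P(1) by (simp add: field_simps)
    moreover have "x / (fact m * P) > 0" using x(1) P(1) by simp
    ultimately have c1: "c = 1" using c(1) by (metis norm_of_real abs_of_pos of_real_1)
    have voff: "v z = 0" "V z = 0" if "\<not> norm z < 1" for z
      using v(1) VH that by (auto simp: inner_functions_def Hinf_def Hol_disc_def)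
    have "v z = on_disc (blaschke as) z" "V z = on_disc F z" for z
      using c(2,3)[of z] c1 voff[of z] by (auto simp: on_disc_def)
    then show ?thesis by auto
  qed
  show "Q_inn f = on_disc (blaschke as)"
    unfolding Q_inn_def by (rule the_equality) (use fact uniq in blast)+
  show "Q_out f = on_disc F"
    unfolding Q_out_def by (rule the_equality) (use fact uniq in blast)+
qed

section \<open>Stability of the outer part\<close>

lemma uniform_limit_from_circle:
  assumes f: "\<And>k. disc_algebra (f k)" and g: "disc_algebra g"
    and lim: "uniform_limit (sphere 0 1) f g sequentially"
  shows "uniform_limit (cball 0 1) f g sequentially"
proof (rule uniform_limitI)
  fix e :: real assume e: "e > 0"
  then have "\<forall>\<^sub>F k in sequentially. \<forall>z\<in>sphere 0 1. dist (f k z) (g z) < e / 2"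
    using lim by (intro uniform_limitD) auto
  then show "\<forall>\<^sub>F k in sequentially. \<forall>z\<in>cball 0 1. dist (f k z) (g z) < e"
  proof eventually_elim
    case (elim k)
    have "norm (f k z - g z) \<le> e / 2" if "norm z \<le> 1" for z
      by (rule disc_algebra_max_modulus[of "\<lambda>z. f k z - g z"])
         (use elim that f g in \<open>auto intro!: disc_algebra_intros less_imp_le simp: dist_norm\<close>)
    then show ?case using e by (force simp: dist_norm)
  qed
qed

lemma uniform_limit_blaschke_factor:
  assumes A: "A \<longlonglongrightarrow> a" and a: "norm a < 1" "a \<noteq> 0"
  shows "uniform_limit (sphere 0 1) (\<lambda>k. blaschke_factor (A k)) (blaschke_factor a) sequentially"
proof (rule uniform_limitI)
  fix e :: real assume e: "e > 0"
  define \<rho> where "\<rho> = min (norm a) (1 - norm a) / 2"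
  have \<rho>: "\<rho> > 0" "\<rho> < norm a" "norm a + \<rho> < 1" using a by (auto simp: \<rho>_def min_def field_simps)
  let ?K = "cball a \<rho> \<times> sphere (0::complex) 1"
  have K: "c \<noteq> 0" "norm c < 1" if "c \<in> cball a \<rho>" for c
  proof -
    have "norm (a - c) \<le> \<rho>" using that by (simp add: dist_norm)
    moreover have "norm a \<le> norm (a - c) + norm c" "norm c \<le> norm (a - c) + norm a"
      using norm_triangle_ineq[of "a - c" c] norm_triangle_ineq[of "c - a" a] by (simp_all add: norm_minus_commute)
    ultimately show "c \<noteq> 0" "norm c < 1" using \<rho> by auto
  qed
  have "continuous_on ?K (\<lambda>x. cnj (sgn (fst x)) * (fst x - snd x) / (1 - cnj (fst x) * snd x))"
    using K one_minus_cnj_mult_nonzero by (intro continuous_intros) force+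
  then have "uniformly_continuous_on ?K (\<lambda>x. cnj (sgn (fst x)) * (fst x - snd x) / (1 - cnj (fst x) * snd x))"
    by (intro compact_uniformly_continuous compact_Times) auto
  then obtain d where d: "d > 0" "\<And>x x'. x \<in> ?K \<Longrightarrow> x' \<in> ?K \<Longrightarrow> dist x' x < d \<Longrightarrow>
      dist (cnj (sgn (fst x')) * (fst x' - snd x') / (1 - cnj (fst x') * snd x'))
        (cnj (sgn (fst x)) * (fst x - snd x) / (1 - cnj (fst x) * snd x)) < e"
    using e unfolding uniformly_continuous_on_def by metis
  have "\<forall>\<^sub>F k in sequentially. dist (A k) a < min d \<rho>"
    using A d \<rho> by (intro tendstoD) auto
  then show "\<forall>\<^sub>F k in sequentially. \<forall>z\<in>sphere 0 1. dist (blaschke_factor (A k) z) (blaschke_factor a z) < e"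
  proof eventually_elim
    case (elim k)
    show ?case
    proof
      fix z :: complex assume z: "z \<in> sphere 0 1"
      have Ak: "A k \<in> cball a \<rho>" using elim by (simp add: dist_commute)
      have "dist (A k, z) (a, z) < d" using elim by (simp add: dist_Pair_Pair)
      then show "dist (blaschke_factor (A k) z) (blaschke_factor a z) < e"
        using d(2)[of "(a, z)" "(A k, z)"] Ak z K(1)[OF Ak] a \<rho> by (simp add: blaschke_factor_def)
    qed
  qed
qed

text \<open>
  The case of a limit \<open>F\<close> that is outer. Let \<open>c\<^sub>k\<close> be the Blaschke product of \<open>bs k\<close>. Since \<open>c\<^sub>k G\<^sub>k\<close> is
  close to \<open>F\<close> and \<open>p F\<close> is close to \<open>1\<close> for a suitable polynomial \<open>p\<close>, the product \<open>c\<^sub>k (p G\<^sub>k)\<close> is close to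
  \<open>1\<close>; hence \<open>c\<^sub>k(0)\<close> tends to \<open>1\<close>, and the total distance \<open>S k\<close> of its zeros to the circle tends to \<open>0\<close>.
  On the circle \<open>\<bar>G\<^sub>k\<bar> = \<bar>c\<^sub>k G\<^sub>k\<bar>\<close>, so where \<open>F\<close> is small, \<open>G\<^sub>k\<close> is small too. Where \<open>F\<close> is not small,
  the zeros of \<open>c\<^sub>k\<close> are far away, because \<open>F\<close> is nearly \<open>0\<close> at them, and so \<open>c\<^sub>k\<close> is close to \<open>1\<close>. The
  maximum principle carries the estimate into the disc.
\<close>

lemma outer_part_converges_base:
  assumes F: "disc_algebra F" "cyclic F"
    and G: "\<And>k. disc_algebra (G k)"
    and bs: "\<And>k b. b \<in> set (bs k) \<Longrightarrow> norm b < 1 \<and> b \<noteq> 0"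
    and lim: "uniform_limit (cball 0 1) (\<lambda>k z. blaschke (bs k) z * G k z) F sequentially"
  shows "uniform_limit (cball 0 1) G F sequentially"
proof (rule uniform_limit_from_circle[OF G F(1)], rule uniform_limitI)
  define S where "S k = (\<Sum>b\<leftarrow>bs k. 1 - norm b)" for k
  have b1: "\<And>k b. b \<in> set (bs k) \<Longrightarrow> norm b < 1" using bs by blast
  have close: "\<forall>\<^sub>F k in sequentially. \<forall>z\<in>cball 0 1. norm (blaschke (bs k) z * G k z - F z) < e" if "e > 0" for e
    using uniform_limitD[OF lim that] by (simp add: dist_norm)
  have S_nonneg: "0 \<le> S k" for k unfolding S_def using b1[of _ k] by (intro sum_list_nonneg) (auto intro: less_imp_le)
  have S_small: "\<forall>\<^sub>F k in sequentially. S k < \<eta>" if \<eta>: "\<eta> > 0" for \<eta>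
  proof -
    \<comment> \<open>chosen so that \<open>(1 - 2 e) (1 + S) \<le> 1 + 2 e\<close> implies \<open>S < \<eta>\<close>\<close>
    define e where "e = \<eta> / (4 + 4 * \<eta>)"
    have e: "e > 0" using \<eta> by (simp add: e_def)
    obtain p where p: "\<And>r. r \<in> {0..<1} \<Longrightarrow> mean2 (\<lambda>z. poly p z * F z - 1) r \<le> e"
      using cyclicD[OF F(2) e] by blast
    obtain M where M: "M > 0" "\<And>z. norm z < 1 \<Longrightarrow> norm (poly p z) \<le> M"
      using poly_bounded_on_disc by blast
    have "e / M > 0" using e M by simp
    from close[OF this] show ?thesis
    proof eventually_elim
      case (elim k)
      let ?u = "on_disc (blaschke (bs k))"
      have cG: "disc_algebra (\<lambda>z. blaschke (bs k) z * G k z)"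
        by (intro disc_algebra_intros blaschke_disc_algebra G b1)
      have pG: "disc_algebra (\<lambda>z. poly p z * G k z)" by (intro disc_algebra_intros G)
      obtain B where B: "\<And>z. norm z \<le> 1 \<Longrightarrow> norm (poly p z * G k z) \<le> B"
        using disc_algebra_bound[OF pG] by blast
      have "1 - 2 * e \<le> norm (?u 0) * (1 + 2 * e)"
      proof (rule inner_near_one_at_0[OF blaschke_inner[OF b1] disc_algebra_hol[OF pG], where B = B])
        fix r :: real assume r: "r \<in> {0..<1}"
        have "mean2 (\<lambda>z. ?u z * (poly p z * G k z) - 1) r
            = mean2 (\<lambda>z. poly p z * (blaschke (bs k) z * G k z - F z) + (poly p z * F z - 1)) r"
          using r by (intro mean2_cong) (auto simp: on_disc_in algebra_simps)
        also have "\<dots> \<le> mean2 (\<lambda>z. poly p z * (blaschke (bs k) z * G k z - F z)) r + mean2 (\<lambda>z. poly p z * F z - 1) r"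
          by (intro mean2_add_le disc_algebra_hol disc_algebra_intros cG F r)
        also have "mean2 (\<lambda>z. poly p z * (blaschke (bs k) z * G k z - F z)) r \<le> M * mean2 (\<lambda>z. blaschke (bs k) z * G k z - F z) r"
          by (intro mean2_mult_le disc_algebra_hol disc_algebra_intros cG F r M)
        also have "\<dots> \<le> M * (e / M)"
          using elim M r by (intro mult_left_mono mean2_le_sup disc_algebra_hol disc_algebra_intros cG F)
             (auto intro: less_imp_le)
        finally show "mean2 (\<lambda>z. ?u z * (poly p z * G k z) - 1) r \<le> 2 * e" using p[OF r] M by simp
      qed (use B in auto)
      moreover define P where "P = (\<Prod>b\<leftarrow>bs k. norm b)"
      have P0: "P \<ge> 0" unfolding P_def by (intro prod_list_nonneg) auto
      ultimately have "1 - 2 * e \<le> P * (1 + 2 * e)"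
        by (simp add: on_disc_in blaschke_0 P_def[symmetric] norm_of_real)
      then have "(1 - 2 * e) * (1 + S k) \<le> P * (1 + 2 * e) * (1 + S k)"
        using S_nonneg[of k] by (intro mult_right_mono) auto
      also have "\<dots> = (P * (1 + S k)) * (1 + 2 * e)" by (simp add: mult_ac)
      also have "\<dots> \<le> 1 * (1 + 2 * e)"
        using prod_norm_sum_le[of "bs k", OF b1] e by (intro mult_right_mono) (auto simp: P_def S_def)
      finally have "S k * (1 - 2 * e) \<le> 4 * e" by (simp add: algebra_simps)
      then have "S k * (1 - 2 * e) * (4 + 4 * \<eta>) \<le> 4 * e * (4 + 4 * \<eta>)"
        using \<eta> by (intro mult_right_mono) auto
      then have "S k * (4 + 4 * \<eta>) - 2 * S k * (e * (4 + 4 * \<eta>)) \<le> 4 * (e * (4 + 4 * \<eta>))"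
        by (simp add: algebra_simps)
      moreover have "e * (4 + 4 * \<eta>) = \<eta>" using \<eta> by (simp add: e_def)
      ultimately have "S k * (4 + 4 * \<eta>) - 2 * S k * \<eta> \<le> 4 * \<eta>" by (simp only:)
      then have "S k * (2 + \<eta>) \<le> 2 * \<eta>" by (simp add: algebra_simps)
      moreover have "\<eta> * (2 + \<eta>) > 2 * \<eta>" using \<eta> by (simp add: algebra_simps)
      ultimately have "S k * (2 + \<eta>) < \<eta> * (2 + \<eta>)" by linarith
      then show "S k < \<eta>" using \<eta> by (simp add: mult_less_cancel_right)
    qed
  qed
  fix \<epsilon> :: real assume \<epsilon>: "\<epsilon> > 0"
  define \<eta> where "\<eta> = \<epsilon> / 8"
  have \<eta>: "\<eta> > 0" using \<epsilon> by (simp add: \<eta>_def)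
  obtain M where M: "M > 0" "\<And>z. norm z \<le> 1 \<Longrightarrow> norm (F z) \<le> M"
    using disc_algebra_bound[OF F(1)] by blast
  have "uniformly_continuous_on (cball 0 1) F"
    by (intro compact_uniformly_continuous disc_algebra_cont F compact_cball)
  then obtain \<delta> where \<delta>: "\<delta> > 0"
    "\<And>z w. z \<in> cball 0 1 \<Longrightarrow> w \<in> cball 0 1 \<Longrightarrow> dist w z < \<delta> \<Longrightarrow> dist (F w) (F z) < \<eta>"
    using \<eta> unfolding uniformly_continuous_on_def by metis
  have "\<eta> * \<delta> / (2 * (M + \<eta>)) > 0" using \<eta> \<delta> M by simp
  from S_small[OF this] close[OF \<eta>]
  show "\<forall>\<^sub>F k in sequentially. \<forall>z\<in>sphere 0 1. dist (G k z) (F z) < \<epsilon>"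
  proof eventually_elim
    case (elim k)
    define c where "c = blaschke (bs k)"
    have cl: "norm (c z * G k z - F z) < \<eta>" if "norm z \<le> 1" for z using elim(2) that by (auto simp: c_def)
    have zero: "norm (F b) < \<eta>" if "b \<in> set (bs k)" for b
    proof -
      have "norm b \<le> 1" using b1[OF that] by simp
      then have "c b = 0" "norm (c b * G k b - F b) < \<eta>"
        using cl[of b] blaschke_eq_0_iff[of "bs k" b] b1 that by (auto simp: c_def)
      then show ?thesis by simp
    qed
    show ?case
    proof
      fix z :: complex assume "z \<in> sphere 0 1"
      then have z: "norm z = 1" by simp
      have c1: "norm (c z) = 1" unfolding c_def by (rule norm_blaschke_circle[OF b1 z])
      then have Gc: "norm (G k z) = norm (c z * G k z)" by (simp add: norm_mult)
      have cz: "norm (c z * G k z - F z) < \<eta>" using cl z by simp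
      have Gle: "norm (G k z) \<le> norm (F z) + \<eta>"
        using norm_triangle_sub[of "c z * G k z" "F z"] cz Gc by linarith
      show "dist (G k z) (F z) < \<epsilon>"
      proof (cases "norm (F z) < 2 * \<eta>")
        case True
        have "norm (G k z - F z) \<le> norm (G k z) + norm (F z)" by (rule norm_triangle_ineq4)
        then show ?thesis using True Gle \<eta> by (simp add: dist_norm \<eta>_def)
      next
        case False
        have far: "\<delta> \<le> norm (z - b)" if b: "b \<in> set (bs k)" for b
        proof (rule ccontr)
          assume "\<not> \<delta> \<le> norm (z - b)"
          then have "norm (F z - F b) < \<eta>"
            using \<delta>(2)[of b z] z b1[OF b] by (simp add: dist_norm)
          then show False using zero[OF b] False norm_triangle_sub[of "F z" "F b"] by linarith
        qed
        have "norm (1 - c z) \<le> 2 / \<delta> * S k"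
          unfolding c_def S_def using bs far z \<delta> by (intro norm_one_minus_blaschke) auto
        also have "\<dots> < 2 / \<delta> * (\<eta> * \<delta> / (2 * (M + \<eta>)))"
          using elim(1) \<delta> by (intro mult_strict_left_mono) auto
        also have "\<dots> = \<eta> / (M + \<eta>)" using \<delta> M \<eta> by (simp add: field_simps)
        finally have "norm (1 - c z) \<le> \<eta> / (M + \<eta>)" by simp
        moreover have "norm (G k z) \<le> M + \<eta>" using Gle M(2)[of z] z by simp
        ultimately have "norm (G k z) * norm (1 - c z) \<le> (M + \<eta>) * (\<eta> / (M + \<eta>))"
          using M \<eta> by (intro mult_mono) auto
        then have "norm (G k z * (1 - c z)) \<le> \<eta>" using M \<eta> by (simp add: norm_mult)
        moreover have "G k z - F z = G k z * (1 - c z) + (c z * G k z - F z)" by (simp add: algebra_simps)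
        then have "norm (G k z - F z) \<le> norm (G k z * (1 - c z)) + norm (c z * G k z - F z)"
          by (metis norm_triangle_ineq)
        ultimately have "norm (G k z - F z) < 2 * \<eta>" using cz by linarith
        then show ?thesis using \<eta> by (simp add: dist_norm \<eta>_def)
      qed
    qed
  qed
qed

text \<open>
  The existence part of Hurwitz's theorem. If \<open>fs k\<close> had no zero near \<open>a\<close>, the maximum principle for its
  reciprocal would bound \<open>\<bar>fs k a\<bar>\<close> from below by half the minimum of \<open>\<bar>f\<bar>\<close> on a small circle
  about \<open>a\<close>, although \<open>fs k a\<close> tends to \<open>f a = 0\<close>.
\<close>

lemma zeros_approach:
  assumes f: "disc_algebra f" and fk: "\<And>k. disc_algebra (fs k)"
    and lim: "uniform_limit (cball 0 1) fs f sequentially"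
    and a: "norm a < 1" "f a = 0" and fin: "finite Z" "\<And>z. norm z < 1 \<Longrightarrow> f z = 0 \<Longrightarrow> z \<in> Z"
    and d: "d > 0"
  shows "\<forall>\<^sub>F k in sequentially. \<exists>b. norm b < 1 \<and> fs k b = 0 \<and> dist a b < d"
proof -
  obtain d' where d': "d' > 0" "\<And>x. x \<in> Z \<Longrightarrow> x \<noteq> a \<Longrightarrow> d' \<le> dist a x"
    using finite_set_avoid[OF fin(1), of a] by blast
  define \<rho> where "\<rho> = min d' (min d (1 - norm a)) / 2"
  have \<rho>: "\<rho> > 0" "\<rho> < d'" "\<rho> < d" "\<rho> < 1 - norm a" using d' d a by (auto simp: \<rho>_def)
  have in_disc: "norm z < 1" if "z \<in> cball a \<rho>" for z
    using that \<rho> norm_triangle_ineq[of "z - a" a] by (auto simp: dist_norm norm_minus_commute)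
  have "cball a \<rho> \<subseteq> cball 0 1"
  proof
    fix z assume "z \<in> cball a \<rho>"
    from in_disc[OF this] show "z \<in> cball 0 1" by simp
  qed
  then have cont: "continuous_on (cball a \<rho>) h" if "disc_algebra h" for h
    using continuous_on_subset[OF disc_algebra_cont[OF that]] by blast
  have nz: "f z \<noteq> 0" if "z \<in> sphere a \<rho>" for z
  proof
    assume "f z = 0"
    then have "z \<in> Z" using in_disc[of z] that by (intro fin(2)) auto
    then show False using d'(2)[of z] that \<rho> by auto
  qed
  have "\<exists>x\<in>sphere a \<rho>. \<forall>y\<in>sphere a \<rho>. norm (f x) \<le> norm (f y)"
    using \<rho> cont[OF f] by (intro continuous_attains_inf continuous_on_norm) (auto intro: continuous_on_subset)
  then obtain x0 where x0: "x0 \<in> sphere a \<rho>" "\<And>y. y \<in> sphere a \<rho> \<Longrightarrow> norm (f x0) \<le> norm (f y)" by blast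
  define m where "m = norm (f x0)"
  have m: "m > 0" using nz[OF x0(1)] by (simp add: m_def)
  have "\<forall>\<^sub>F k in sequentially. \<forall>z\<in>cball 0 1. dist (fs k z) (f z) < m / 2"
    using m by (intro uniform_limitD[OF lim]) auto
  then show ?thesis
  proof eventually_elim
    case (elim k)
    show ?case
    proof (rule ccontr)
      assume neg: "\<not> ?thesis"
      have nzk: "fs k z \<noteq> 0" if "z \<in> cball a \<rho>" for z
        using neg in_disc[OF that] that \<rho> by auto
      have "norm (1 / fs k a) \<le> 2 / m"
      proof (rule maximum_modulus_frontier[of "\<lambda>z. 1 / fs k z" "cball a \<rho>"])
        show "(\<lambda>z. 1 / fs k z) holomorphic_on interior (cball a \<rho>)"
          by (intro holomorphic_intros holomorphic_on_subset[OF disc_algebra_hol[OF fk]])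
             (use in_disc nzk interior_subset in \<open>auto simp: subset_iff\<close>)
        show "continuous_on (closure (cball a \<rho>)) (\<lambda>z. 1 / fs k z)"
          using nzk cont[OF fk] by (auto intro!: continuous_intros)
        fix z assume "z \<in> frontier (cball a \<rho>)"
        then have z: "z \<in> sphere a \<rho>" using \<rho> by simp
        have "norm (fs k z - f z) < m / 2" using elim in_disc[of z] z by (auto simp: dist_norm)
        moreover have "m \<le> norm (f z)" unfolding m_def by (rule x0(2)[OF z])
        ultimately have "m / 2 \<le> norm (fs k z)"
          using norm_triangle_sub[of "f z" "fs k z"] by (simp add: norm_minus_commute)
        moreover from this have "0 < norm (fs k z)" using m by linarith
        ultimately show "norm (1 / fs k z) \<le> 2 / m" using m by (simp add: norm_divide field_simps)
      qed (use \<rho> in auto)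
      moreover have "a \<in> cball 0 1" using a by simp
      then have "dist (fs k a) (f a) < m / 2" using elim by blast
      then have "norm (fs k a) < m / 2" using a by simp
      moreover have "fs k a \<noteq> 0" using nzk \<rho> by simp
      ultimately show False using m by (simp add: norm_divide field_simps)
    qed
  qed
qed

text \<open>
  Induction on the zeros of the limit. For a zero \<open>a\<close> of the limit, the functions of the sequence have
  zeros \<open>A k\<close> that tend to \<open>a\<close>. As \<open>a \<noteq> 0\<close>, their Blaschke factors converge uniformly on the circle, where
  they are unimodular and can be cancelled. The outer parts are unaffected.
\<close>

proposition outer_part_converges:
  assumes F: "disc_algebra F" "cyclic F"
    and G: "\<And>k. disc_algebra (G k)" "\<And>k. cyclic (G k)"
    and as: "\<And>a. a \<in> set as \<Longrightarrow> norm a < 1 \<and> a \<noteq> 0"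
    and bs: "\<And>k b. b \<in> set (bs k) \<Longrightarrow> norm b < 1 \<and> b \<noteq> 0"
    and lim: "uniform_limit (cball 0 1) (\<lambda>k z. blaschke (bs k) z * G k z) (\<lambda>z. blaschke as z * F z) sequentially"
  shows "uniform_limit (cball 0 1) G F sequentially"
  using as bs lim
proof (induction as arbitrary: bs)
  case Nil
  then show ?case by (intro outer_part_converges_base[OF F G(1), of bs]) auto
next
  case (Cons a as)
  define fs where "fs k z = blaschke (bs k) z * G k z" for k z
  define f where "f z = blaschke (a # as) z * F z" for z
  have a: "norm a < 1" "a \<noteq> 0" using Cons.prems(1) by auto
  have as1: "\<And>b. b \<in> set (a # as) \<Longrightarrow> norm b < 1" and bs1: "\<And>k b. b \<in> set (bs k) \<Longrightarrow> norm b < 1"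
    using Cons.prems by blast+
  have fd: "disc_algebra f" unfolding f_def by (intro disc_algebra_intros blaschke_disc_algebra as1 F)
  have fsd: "disc_algebra (fs k)" for k
    unfolding fs_def by (intro disc_algebra_intros blaschke_disc_algebra bs1 G)
  have fs_lim: "uniform_limit (cball 0 1) fs f sequentially"
    using Cons.prems(3) by (simp add: fs_def [abs_def] f_def [abs_def])
  have near: "\<forall>\<^sub>F k in sequentially. \<exists>b\<in>set (bs k). dist a b < d" if "d > 0" for d
  proof -
    have "\<forall>\<^sub>F k in sequentially. \<exists>b. norm b < 1 \<and> fs k b = 0 \<and> dist a b < d"
    proof (rule zeros_approach[OF fd fsd fs_lim a(1), of "set (a # as)"])
      show "f a = 0" using blaschke_eq_0_iff[of "a # as" a, OF as1] a by (simp add: f_def)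
      show "z \<in> set (a # as)" if "norm z < 1" "f z = 0" for z
        using that cyclic_disc_algebra_nonzero[OF F that(1)] blaschke_eq_0_iff[of "a # as" z, OF as1] by (simp add: f_def)
    qed (use that in auto)
    then show ?thesis
    proof eventually_elim
      case (elim k)
      then obtain b where b: "norm b < 1" "fs k b = 0" "dist a b < d" by blast
      have "b \<in> set (bs k)"
        using b cyclic_disc_algebra_nonzero[OF G b(1)] blaschke_eq_0_iff[of "bs k" b, OF bs1] by (simp add: fs_def)
      then show ?case using b by blast
    qed
  qed
  \<comment> \<open>a nearest zero; the value \<open>a\<close> for an empty list of zeros concerns only finitely many \<open>k\<close>\<close>
  define A where "A k = (if bs k = [] then a else arg_min_on (dist a) (set (bs k)))" for k
  have A_in: "A k \<in> set (bs k)" if "bs k \<noteq> []" for k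
    using that by (auto simp: A_def intro!: arg_min_if_finite)
  have A_min: "dist a (A k) \<le> dist a b" if "b \<in> set (bs k)" for k b
    using that arg_min_if_finite(2)[of "set (bs k)" "dist a"] by (force simp: A_def not_less)
  have "A \<longlonglongrightarrow> a"
  proof (rule tendstoI)
    fix d :: real assume "d > 0"
    from near[OF this] show "\<forall>\<^sub>F k in sequentially. dist (A k) a < d"
      by eventually_elim (use A_min in \<open>force simp: dist_commute\<close>)
  qed
  note A_unif = uniform_limit_blaschke_factor[OF this a]
  define bs' where "bs' k = remove1 (A k) (bs k)" for k
  have bs': "\<And>k b. b \<in> set (bs' k) \<Longrightarrow> norm b < 1 \<and> b \<noteq> 0"
    using Cons.prems(2) set_remove1_subset unfolding bs'_def by fastforce
  have as': "\<And>b. b \<in> set as \<Longrightarrow> norm b < 1 \<and> b \<noteq> 0" using Cons.prems(1) by auto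
  show ?case
  proof (rule Cons.IH[OF as' bs'], assumption, assumption,
      rule uniform_limit_from_circle)
    show "disc_algebra (\<lambda>z. blaschke (bs' k) z * G k z)" for k
      using bs'[of _ k] by (intro disc_algebra_intros blaschke_disc_algebra G) auto
    show gd: "disc_algebra (\<lambda>z. blaschke as z * F z)"
      using as' by (intro disc_algebra_intros blaschke_disc_algebra F) auto
    obtain M where M: "M > 0" "\<And>z. norm z \<le> 1 \<Longrightarrow> norm (blaschke as z * F z) \<le> M"
      using disc_algebra_bound[OF gd] by blast
    show "uniform_limit (sphere 0 1) (\<lambda>k z. blaschke (bs' k) z * G k z) (\<lambda>z. blaschke as z * F z) sequentially"
    proof (rule uniform_limitI)
      fix e :: real assume e: "e > 0"
      have "\<forall>\<^sub>F k in sequentially. \<forall>z\<in>cball 0 1. dist (fs k z) (f z) < e / 2"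
        using e by (intro uniform_limitD[OF fs_lim]) auto
      moreover have "\<forall>\<^sub>F k in sequentially. \<forall>z\<in>sphere 0 1. dist (blaschke_factor (A k) z) (blaschke_factor a z) < e / (2 * M)"
        using e M by (intro uniform_limitD[OF A_unif]) auto
      ultimately show "\<forall>\<^sub>F k in sequentially. \<forall>z\<in>sphere 0 1.
          dist (blaschke (bs' k) z * G k z) (blaschke as z * F z) < e"
        using near[OF zero_less_one]
      proof eventually_elim
        case (elim k)
        have Ak: "A k \<in> set (bs k)" using elim(3) by (intro A_in) auto
        show ?case
        proof
          fix z :: complex assume zs: "z \<in> sphere 0 1"
          then have z: "norm z = 1" by simp
          define x where "x = blaschke_factor (A k) z"
          define y where "y = blaschke_factor a z"
          define g where "g = blaschke as z * F z"
          define h where "h = blaschke (bs' k) z * G k z"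
          have x1: "norm x = 1" unfolding x_def by (rule norm_blaschke_factor_circle[OF bs1[OF Ak] z])
          have fs_eq: "fs k z = x * h"
            by (simp add: fs_def x_def h_def bs'_def blaschke_remove1[OF Ak])
          have f_eq: "f z = y * g" by (simp add: f_def y_def g_def)
          have "x * (h - g) = (fs k z - f z) + (y - x) * g"
            by (simp add: fs_eq f_eq algebra_simps)
          then have "norm (h - g) \<le> norm (fs k z - f z) + norm (y - x) * norm g"
            using x1 norm_triangle_ineq[of "fs k z - f z" "(y - x) * g"] by (metis norm_mult mult_1)
          moreover have "norm (fs k z - f z) < e / 2" using elim(1) z by (auto simp: dist_norm)
          moreover have "norm (y - x) * norm g \<le> e / (2 * M) * M"
            using elim(2) zs M(2)[of z] z e M(1)
            by (intro mult_mono) (auto simp: dist_norm norm_minus_commute x_def y_def g_def intro: less_imp_le)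
          ultimately have "norm (h - g) < e" using M(1) by simp
          then show "dist (blaschke (bs' k) z * G k z) (blaschke as z * F z) < e"
            by (simp add: dist_norm h_def g_def)
        qed
      qed
    qed
  qed
qed

section \<open>Continuity of the factorization maps\<close>

lemma disc_algebra_bound_closure:
  assumes h: "disc_algebra h" and C: "\<And>z. norm z < 1 \<Longrightarrow> norm (h z) \<le> C" and z: "norm z \<le> 1"
  shows "norm (h z) \<le> C"
proof (rule continuous_le_on_closure[of "ball 0 1" "\<lambda>z. norm (h z)" z C])
  show "continuous_on (closure (ball 0 1)) (\<lambda>z. norm (h z))"
    using disc_algebra_cont[OF h] by (intro continuous_on_norm) simp
qed (use z C in auto)

text \<open>
  The common power of \<open>z\<close> has modulus \<open>1\<close> on the circle and is cancelled there, which leaves Blaschke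
  products with nonzero zeros only.
\<close>

lemma Q_factors_converge:
  assumes f: "blaschke_outer_factorization f as F"
    and fk: "\<And>k. blaschke_outer_factorization (fs k) (bs k) (G k)"
    and count: "\<And>k. count_list (bs k) 0 = count_list as 0"
    and close: "\<And>k z. norm z < 1 \<Longrightarrow> norm (f z - fs k z) \<le> D k" and D: "D \<longlonglongrightarrow> 0"
  shows "uniform_limit (cball 0 1) G F sequentially"
proof -
  note f' = blaschke_outer_factorizationD[OF f] and fk' = blaschke_outer_factorizationD[OF fk]
  let ?nz = "filter (\<lambda>a. a \<noteq> 0)"
  have da: "disc_algebra (blaschke as)" "disc_algebra (blaschke (bs k))"
    "disc_algebra (blaschke (?nz as))" "disc_algebra (blaschke (?nz (bs k)))" for k
    using f'(1) fk'(1)[of _ k] by (auto intro!: blaschke_disc_algebra)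
  have le: "norm (blaschke as z * F z - blaschke (bs k) z * G k z) \<le> D k" if "norm z \<le> 1" for z k
  proof (rule disc_algebra_bound_closure[OF _ _ that])
    show "disc_algebra (\<lambda>z. blaschke as z * F z - blaschke (bs k) z * G k z)"
      by (intro disc_algebra_intros da f' fk')
    show "norm (blaschke as w * F w - blaschke (bs k) w * G k w) \<le> D k" if "norm w < 1" for w
      using close[OF that, of k] f'(4)[OF that] fk'(4)[OF that, of k] by simp
  qed
  have eq: "norm (blaschke (?nz as) z * F z - blaschke (?nz (bs k)) z * G k z)
      = norm (blaschke as z * F z - blaschke (bs k) z * G k z)" if "norm z = 1" for z k
  proof -
    have "blaschke as z * F z - blaschke (bs k) z * G k z
      = z ^ count_list as 0 * (blaschke (?nz as) z * F z - blaschke (?nz (bs k)) z * G k z)"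
      unfolding blaschke_power_split[of as] blaschke_power_split[of "bs k"] count by (simp add: algebra_simps)
    then show ?thesis using that by (simp add: norm_mult norm_power)
  qed
  show ?thesis
  proof (rule outer_part_converges[OF f'(2,3) fk'(2,3)])
    show "uniform_limit (cball 0 1) (\<lambda>k z. blaschke (?nz (bs k)) z * G k z) (\<lambda>z. blaschke (?nz as) z * F z) sequentially"
    proof (rule uniform_limit_from_circle, rule disc_algebra_intros(4)[OF da(4) fk'(2)],
        rule disc_algebra_intros(4)[OF da(3) f'(2)], rule uniform_limitI)
      fix e :: real assume "e > 0"
      then have "\<forall>\<^sub>F k in sequentially. D k < e" using D by (rule order_tendstoD(2)[rotated])
      then show "\<forall>\<^sub>F k in sequentially. \<forall>z\<in>sphere 0 1.
          dist (blaschke (?nz (bs k)) z * G k z) (blaschke (?nz as) z * F z) < e"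
      proof eventually_elim
        case (elim k)
        show ?case
        proof
          fix z :: complex assume "z \<in> sphere 0 1"
          then have z: "norm z = 1" by simp
          have "norm (blaschke (?nz as) z * F z - blaschke (?nz (bs k)) z * G k z) < e"
            using eq[OF z, of k] le[of z k] z elim by simp
          then show "dist (blaschke (?nz (bs k)) z * G k z) (blaschke (?nz as) z * F z) < e"
            by (simp add: dist_norm norm_minus_commute)
        qed
      qed
    qed
  qed (use f'(1) fk'(1) in auto)
qed

text \<open>
  Let \<open>u\<close> and \<open>v\<close> be the inner parts of \<open>f\<close> and \<open>fs k\<close>. Convergence of the functions and of their outer
  parts makes \<open>F (u - v) = (f - fs k) + v (G k - F)\<close> uniformly small. As \<open>p F\<close> is close to \<open>1\<close> in mean square
  and \<open>u - v\<close> is bounded, \<open>u - v\<close> is close in mean square to \<open>p F (u - v)\<close>.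
\<close>

lemma inner_part_converges_H2:
  assumes f: "blaschke_outer_factorization f as F"
    and fk: "\<And>k. blaschke_outer_factorization (fs k) (bs k) (G k)"
    and close: "\<And>k z. norm z < 1 \<Longrightarrow> norm (f z - fs k z) \<le> D k" and D: "D \<longlonglongrightarrow> 0"
    and outer: "uniform_limit (cball 0 1) G F sequentially" and e: "e > 0"
  shows "\<forall>\<^sub>F k in sequentially. \<forall>r\<in>{0..<1}. mean2 (\<lambda>z. blaschke as z - blaschke (bs k) z) r \<le> e"
proof -
  note f' = blaschke_outer_factorizationD[OF f] and fk' = blaschke_outer_factorizationD[OF fk]
  obtain p where p: "\<And>r. r \<in> {0..<1} \<Longrightarrow> mean2 (\<lambda>z. poly p z * F z - 1) r \<le> e / 4"
    using cyclicD[OF f'(3), of "e / 4"] e by (meson divide_pos_pos zero_less_numeral)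
  obtain M where M: "M > 0" "\<And>z. norm z < 1 \<Longrightarrow> norm (poly p z) \<le> M"
    using poly_bounded_on_disc by blast
  define d where "d = e / (4 * M)"
  have d: "d > 0" using e M by (simp add: d_def)
  have "\<forall>\<^sub>F k in sequentially. D k < d" using D d by (rule order_tendstoD(2))
  moreover have "\<forall>\<^sub>F k in sequentially. \<forall>z\<in>cball 0 1. dist (G k z) (F z) < d"
    by (rule uniform_limitD[OF outer d])
  ultimately show ?thesis
  proof eventually_elim
    case (elim k)
    define u where "u = blaschke as"
    define v where "v = blaschke (bs k)"
    have uv: "disc_algebra u" "disc_algebra v" using f'(1) fk'(1)[of _ k] by (auto simp: u_def v_def intro!: blaschke_disc_algebra)
    have uv1: "norm (u z) \<le> 1" "norm (v z) \<le> 1" if "norm z < 1" for z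
      using that f'(1) fk'(1)[of _ k] by (auto simp: u_def v_def intro!: norm_blaschke_le)
    show ?case unfolding u_def[symmetric] v_def[symmetric]
    proof
      fix r :: real assume r: "r \<in> {0..<1}"
      have 1: "norm (v z - u z) \<le> 2" if "norm z < 1" for z
        using norm_triangle_ineq4[of "v z" "u z"] uv1[OF that] by linarith
      have 2: "norm (poly p z * (F z * (u z - v z))) \<le> M * (2 * d)" if z: "norm z < 1" for z
      proof -
        have "F z * (u z - v z) = (f z - fs k z) + v z * (G k z - F z)"
          using f'(4)[OF z] fk'(4)[OF z, of k] by (simp add: u_def v_def algebra_simps)
        then have "norm (F z * (u z - v z)) \<le> norm (f z - fs k z) + norm (v z * (G k z - F z))"
          by (metis norm_triangle_ineq)
        also have "norm (v z * (G k z - F z)) \<le> 1 * d"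
          unfolding norm_mult using uv1[OF z] elim(2) z d
          by (intro mult_mono) (auto simp: dist_norm intro: less_imp_le)
        finally have "norm (F z * (u z - v z)) \<le> 2 * d" using close[OF z, of k] elim(1) by linarith
        then show ?thesis unfolding norm_mult[of "poly p z"] using M z d by (intro mult_mono) auto
      qed
      have "mean2 (\<lambda>z. u z - v z) r
         = mean2 (\<lambda>z. (v z - u z) * (poly p z * F z - 1) + poly p z * (F z * (u z - v z))) r"
        by (simp add: algebra_simps)
      also have "\<dots> \<le> mean2 (\<lambda>z. (v z - u z) * (poly p z * F z - 1)) r + mean2 (\<lambda>z. poly p z * (F z * (u z - v z))) r"
        by (intro mean2_add_le disc_algebra_hol disc_algebra_intros uv f' r)
      also have "mean2 (\<lambda>z. (v z - u z) * (poly p z * F z - 1)) r \<le> 2 * mean2 (\<lambda>z. poly p z * F z - 1) r"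
        using 1 by (intro mean2_mult_le disc_algebra_hol disc_algebra_intros uv f' r) auto
      also have "mean2 (\<lambda>z. poly p z * (F z * (u z - v z))) r \<le> M * (2 * d)"
        using 2 by (intro mean2_le_sup disc_algebra_hol disc_algebra_intros uv f' r) auto
      finally show "mean2 (\<lambda>z. u z - v z) r \<le> e" using p[OF r] M by (simp add: d_def)
    qed
  qed
qed

lemma continuous_map_from_sequences:
  assumes M: "Metric_space M d" and M': "Metric_space M' d'" and img: "f ` M \<subseteq> M'"
    and lim: "\<And>a x e. a \<in> M \<Longrightarrow> (\<And>k::nat. x k \<in> M) \<Longrightarrow> (\<lambda>k. d a (x k)) \<longlonglongrightarrow> 0 \<Longrightarrow> e > 0 \<Longrightarrow>
      \<forall>\<^sub>F k in sequentially. d' (f a) (f (x k)) < e"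
  shows "continuous_map (Metric_space.mtopology M d) (Metric_space.mtopology M' d') f"
proof -
  interpret Metric_space M d by (rule M)
  have "\<exists>\<delta>>0. \<forall>x. x \<in> M \<and> d a x < \<delta> \<longrightarrow> d' (f a) (f x) < e" if a: "a \<in> M" and e: "e > 0" for a e
  proof (rule ccontr)
    assume neg: "\<not> ?thesis"
    have "\<exists>x. x \<in> M \<and> d a x < inverse (Suc k) \<and> \<not> d' (f a) (f x) < e" for k :: nat
    proof -
      have "inverse (real (Suc k)) > 0" by simp
      then show ?thesis using neg by blast
    qed
    then obtain x where x: "\<And>k::nat. x k \<in> M" "\<And>k. d a (x k) < inverse (Suc k)" "\<And>k. \<not> d' (f a) (f (x k)) < e"
      by metis
    have "(\<lambda>k. d a (x k)) \<longlonglongrightarrow> 0"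
      by (rule tendsto_sandwich[OF _ _ tendsto_const LIMSEQ_inverse_real_of_nat])
         (use x(2) in \<open>auto intro!: always_eventually less_imp_le simp del: of_nat_Suc\<close>)
    then have "\<forall>\<^sub>F k in sequentially. d' (f a) (f (x k)) < e" by (rule lim[OF a x(1) _ e])
    then show False using x(3) by simp
  qed
  then show ?thesis using metric_continuous_map[OF M'] img by blast
qed

lemma Hol_nD:
  assumes "f \<in> Hol_n n"
  shows "f \<in> Hinf" "f \<in> Hol_disc" "\<exists>as F. blaschke_outer_factorization f as F"
    "blaschke_outer_factorization f as F \<Longrightarrow> count_list as 0 = n"
  using assms exists_blaschke_outer_factorization[of f] Q_values(3)[of f as F]
  by (auto simp: Hol_n_def Hol_closed_disc_def Hinf_def)

lemma Q_in:
  assumes "f \<in> Hol_n n"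
  shows "Q_inn f \<in> inner_functions" "Q_out f \<in> outer_functions"
proof -
  obtain as F where "blaschke_outer_factorization f as F" using Hol_nD(3)[OF assms] by blast
  from Q_values[OF this Hol_nD(2)[OF assms]]
  show "Q_inn f \<in> inner_functions" "Q_out f \<in> outer_functions" by simp_all
qed

proposition Q_sequentially_continuous:
  assumes f: "f \<in> Hol_n n" and fs: "\<And>k. fs k \<in> Hol_n n"
    and lim: "(\<lambda>k. Hinf_dist f (fs k)) \<longlonglongrightarrow> 0" and e: "e > 0"
  shows "\<forall>\<^sub>F k in sequentially. Hinf_dist (Q_out f) (Q_out (fs k)) < e"
    "\<forall>\<^sub>F k in sequentially. H2_dist (Q_inn f) (Q_inn (fs k)) < e"
proof -
  obtain as F where bo: "blaschke_outer_factorization f as F" using Hol_nD(3)[OF f] by blast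
  obtain bs G where bok: "\<And>k. blaschke_outer_factorization (fs k) (bs k) (G k)"
    using Hol_nD(3)[OF fs] by metis
  have close: "norm (f z - fs k z) \<le> Hinf_dist f (fs k)" for z k
    using norm_le_Hinf_norm[OF Hinf_diff[OF Hol_nD(1)[OF f] Hol_nD(1)[OF fs]], of z k]
    by (simp add: Hinf_dist_def Hol_nD(1)[OF f] Hol_nD(1)[OF fs])
  have count: "count_list (bs k) 0 = count_list as 0" for k
    using Hol_nD(4)[OF f bo] Hol_nD(4)[OF fs bok] by simp
  have GF: "uniform_limit (cball 0 1) G F sequentially"
    by (rule Q_factors_converge[OF bo bok count close lim])
  note Q = Q_values[OF bo Hol_nD(2)[OF f]] and Qk = Q_values[OF bok Hol_nD(2)[OF fs]]
  have H: "on_disc F \<in> Hinf" "on_disc (G k) \<in> Hinf" for k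
    using Q(5) Qk(5)[of k] by (auto simp: outer_functions_def)
  have "\<forall>\<^sub>F k in sequentially. \<forall>z\<in>cball 0 1. dist (G k z) (F z) < e / 2"
    using e by (intro uniform_limitD[OF GF]) auto
  then show "\<forall>\<^sub>F k in sequentially. Hinf_dist (Q_out f) (Q_out (fs k)) < e"
  proof eventually_elim
    case (elim k)
    have "Hinf_norm (\<lambda>z. on_disc F z - on_disc (G k) z) \<le> e / 2"
      using elim e by (intro Hinf_norm_le) (auto simp: on_disc_def dist_norm norm_minus_commute intro!: less_imp_le)
    then show ?case using e H by (simp add: Q(2) Qk(2) Hinf_dist_def)
  qed
  have H2: "on_disc (blaschke as) \<in> H2" "on_disc (blaschke (bs k)) \<in> H2" for k
    using Q(4) Qk(4)[of k] Hinf_subset_H2 by (auto simp: inner_functions_def)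
  have "e / 2 > 0" using e by simp
  from inner_part_converges_H2[OF bo bok close lim GF this]
  show "\<forall>\<^sub>F k in sequentially. H2_dist (Q_inn f) (Q_inn (fs k)) < e"
  proof eventually_elim
    case (elim k)
    have "mean2 (\<lambda>z. on_disc (blaschke as) z - on_disc (blaschke (bs k)) z) r \<le> e / 2" if r: "r \<in> {0..<1}" for r
      using elim r mean2_cong[of "\<lambda>z. on_disc (blaschke as) z - on_disc (blaschke (bs k)) z"
          "\<lambda>z. blaschke as z - blaschke (bs k) z" r] by (simp add: on_disc_in)
    then show ?case unfolding Q(1) Qk(1) using e by (intro H2_dist_lt[OF H2, where e = "e / 2"]) auto
  qed
qed

text \<open>
  The zero \<open>a\<close> contributes a Blaschke factor to the inner part as long as \<open>a < 1\<close>, and nothing for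
  \<open>a = 1\<close>. These are the functions that witness the discontinuity.
\<close>

lemma power_times_linear:
  fixes a :: real
  assumes a: "0 < a" "a \<le> 1"
  shows "on_disc (\<lambda>z. z ^ n * (z - of_real a)) \<in> Hol_n n"
    "Q_inn (on_disc (\<lambda>z. z ^ n * (z - of_real a)))
      = on_disc (blaschke ((if a < 1 then [of_real a] else []) @ replicate n 0))"
proof -
  define f where "f = on_disc (\<lambda>z. z ^ n * (z - of_real a))"
  define as where "as = (if a < 1 then [complex_of_real a] else []) @ replicate n 0"
  have d: "disc_algebra (\<lambda>z. z ^ n * (z - of_real a))"
    unfolding disc_algebra_def by (auto intro!: continuous_intros holomorphic_intros)
  have fH: "f \<in> Hinf" unfolding f_def by (rule disc_algebra_Hinf[OF d])
  have "blaschke_outer_factorization f as (blaschke_unit (of_real a))"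
    unfolding blaschke_outer_factorization_def
  proof (intro conjI allI impI blaschke_unit_disc_algebra cyclic_blaschke_unit)
    fix z :: complex assume z: "norm z < 1"
    show "f z = blaschke as z * blaschke_unit (of_real a) z"
    proof (cases "a < 1")
      case True
      then have "blaschke_factor (of_real a) z * blaschke_unit (of_real a) z = z - of_real a"
        using a z by (intro blaschke_factor_unit) auto
      then show ?thesis using True z by (simp add: f_def as_def on_disc_in blaschke_replicate_0 mult_ac)
    next
      case False
      then show ?thesis using a z blaschke_unit_circle[of "of_real a" z]
        by (simp add: f_def as_def on_disc_in blaschke_replicate_0)
    qed
  qed (use a in \<open>auto simp: as_def\<close>)
  note Q = Q_values[OF this]
  have fD: "f \<in> Hol_disc" using fH by (simp add: Hinf_def)
  have "f \<in> Hol_closed_disc"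
    unfolding Hol_closed_disc_def
  proof (intro CollectI conjI fH exI)
    show "(\<lambda>z. z ^ n * (z - of_real a)) holomorphic_on UNIV" by (intro holomorphic_intros)
  qed (auto simp: f_def on_disc_in)
  moreover have "count_list (replicate m (0::complex)) 0 = m" for m by (induction m) auto
  then have "count_list as 0 = n" using a by (auto simp: as_def)
  then have "Mul0 f = n" using Q(3)[OF fD] by simp
  moreover have "f \<noteq> (\<lambda>z. 0)"
  proof
    assume "f = (\<lambda>z. 0)"
    then have "f (of_real (a / 2)) = 0" by simp
    moreover have "f (of_real (a / 2)) = of_real ((a / 2) ^ n * (a / 2 - a))"
      using a by (simp add: f_def on_disc_in)
    ultimately show False using a by (simp del: of_real_mult of_real_diff of_real_power)
  qed
  ultimately show "on_disc (\<lambda>z. z ^ n * (z - of_real a)) \<in> Hol_n n"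
    by (simp add: Hol_n_def f_def)
  show "Q_inn (on_disc (\<lambda>z. z ^ n * (z - of_real a)))
      = on_disc (blaschke ((if a < 1 then [of_real a] else []) @ replicate n 0))"
    using Q(1)[OF fD] by (simp add: f_def as_def)
qed

text \<open>
  As \<open>a\<close> increases to \<open>1\<close>, \<open>z\<^sup>n (z - a)\<close> tends uniformly to \<open>z\<^sup>n (z - 1)\<close>. Its inner part vanishes at \<open>a\<close>,
  while the inner part of the limit is \<open>z\<^sup>n\<close>, with the value \<open>a\<^sup>n\<close> there, which tends to \<open>1\<close>.
\<close>

lemma Q_inn_not_continuous: "\<not> continuous_map (Hinf_top (Hol_n n)) (Hinf_top inner_functions) Q_inn"
proof
  assume "continuous_map (Hinf_top (Hol_n n)) (Hinf_top inner_functions) Q_inn"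
  then have *: "continuous_map (Metric_space.mtopology (Hol_n n) Hinf_dist)
      (Metric_space.mtopology inner_functions Hinf_dist) Q_inn"
    by (simp add: Hinf_top_def)
  interpret Metric_space "Hol_n n" Hinf_dist by (rule Metric_space_Hinf[OF subsets_of_Hinf(3)])
  define g where "g a = on_disc (\<lambda>z. z ^ n * (z - of_real a))" for a :: real
  have g: "g a \<in> Hol_n n" "Q_inn (g a) = on_disc (blaschke ((if a < 1 then [of_real a] else []) @ replicate n 0))"
    if "0 < a" "a \<le> 1" for a
    using power_times_linear[OF that, of n] by (simp_all add: g_def)
  obtain \<delta> where \<delta>: "\<delta> > 0"
    "\<And>h. h \<in> Hol_n n \<Longrightarrow> Hinf_dist (g 1) h < \<delta> \<Longrightarrow> Hinf_dist (Q_inn (g 1)) (Q_inn h) < 1 / 2"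
    using * g(1)[of 1] unfolding metric_continuous_map[OF Metric_space_Hinf[OF subsets_of_Hinf(1)]]
    by (metis half_gt_zero_iff less_imp_le zero_less_one order_refl)
  have "((\<lambda>a::real. a ^ n) \<longlongrightarrow> 1 ^ n) (at_left 1)" by (intro tendsto_intros)
  then have "\<forall>\<^sub>F a in at_left 1. 1 / 2 < (a::real) ^ n" by (rule order_tendstoD) simp
  moreover have "\<forall>\<^sub>F a in at_left 1. a \<in> {max 0 (1 - \<delta> / 2)<..<1}"
    using \<delta>(1) by (intro eventually_at_left_real) auto
  ultimately have "\<forall>\<^sub>F a in at_left 1. 1 / 2 < (a::real) ^ n \<and> a \<in> {max 0 (1 - \<delta> / 2)<..<1}"
    by (rule eventually_conj)
  then obtain a :: real where a: "1 / 2 < a ^ n" "0 < a" "a < 1" "1 - a < \<delta> / 2"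
    using eventually_happens'[OF trivial_limit_at_left_real] by fastforce
  have gH: "g 1 \<in> Hinf" "g a \<in> Hinf" using g(1)[of 1] g(1)[of a] a subsets_of_Hinf(3) by auto
  have "Hinf_norm (\<lambda>z. g 1 z - g a z) \<le> 1 - a"
  proof (rule Hinf_norm_le)
    fix z
    show "norm (g 1 z - g a z) \<le> 1 - a"
    proof (cases "norm z < 1")
      case True
      have "g 1 z - g a z = z ^ n * of_real (a - 1)"
        using True by (simp add: g_def on_disc_in algebra_simps)
      then have "norm (g 1 z - g a z) = norm z ^ n * (1 - a)"
        using a by (simp add: norm_mult norm_power del: of_real_diff)
      also have "\<dots> \<le> 1 * (1 - a)" using True a by (intro mult_right_mono power_le_one) auto
      finally show ?thesis by simp
    qed (use a in \<open>auto simp: g_def on_disc_def\<close>)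
  qed
  then have "Hinf_dist (g 1) (g a) < \<delta>" using a gH \<delta>(1) by (simp add: Hinf_dist_def)
  then have lt: "Hinf_dist (Q_inn (g 1)) (Q_inn (g a)) < 1 / 2" using \<delta>(2) g(1)[of a] a by simp
  have QH: "Q_inn (g 1) \<in> Hinf" "Q_inn (g a) \<in> Hinf"
    using Q_in(1)[OF g(1)] a subsets_of_Hinf(1) by auto
  have "a ^ n = norm (Q_inn (g 1) (of_real a) - Q_inn (g a) (of_real a))"
    using a g(2)[of 1] g(2)[of a] blaschke_factor_eq_0_iff[of "of_real a" "of_real a"]
    by (simp add: on_disc_in blaschke_replicate_0 norm_power)
  also have "\<dots> \<le> Hinf_dist (Q_inn (g 1)) (Q_inn (g a))"
    using norm_le_Hinf_norm[OF Hinf_diff[OF QH]] QH by (simp add: Hinf_dist_def)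
  finally show False using lt a(1) by simp
qed

theorem theorem4p1:
  fixes n :: nat
  shows "continuous_map (Hinf_top (Hol_n n)) (Hinf_top outer_functions) Q_out
    \<and> \<not> continuous_map (Hinf_top (Hol_n n)) (Hinf_top inner_functions) Q_inn
    \<and> continuous_map (Hinf_top (Hol_n n)) (H2_top inner_functions) Q_inn
    \<and> continuous_map (Hinf_top (Hol_n n)) (H2_top outer_functions) Q_out"
proof -
  note H2s = order_trans[OF subsets_of_Hinf(1) Hinf_subset_H2] order_trans[OF subsets_of_Hinf(2) Hinf_subset_H2]
  note spaces = Metric_space_Hinf[OF subsets_of_Hinf(3)]
    Metric_space_Hinf[OF subsets_of_Hinf(2)] Metric_space_H2[OF H2s(1)] Metric_space_H2[OF H2s(2)]
  have img: "Q_inn ` Hol_n n \<subseteq> inner_functions" "Q_out ` Hol_n n \<subseteq> outer_functions"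
    using Q_in by blast+
  have le: "H2_dist F G \<le> Hinf_dist F G" if "F \<in> Hinf" "G \<in> Hinf" for F G
  proof -
    have FG: "(\<lambda>z. F z - G z) \<in> Hinf" by (rule Hinf_diff[OF that])
    then have "(\<lambda>z. F z - G z) \<in> Hol_disc" by (simp add: Hinf_def)
    then have "H2_norm (\<lambda>z. F z - G z) \<le> Hinf_norm (\<lambda>z. F z - G z)"
      by (intro H2_norm_le mean2_le_bound norm_le_Hinf_norm[OF FG])
    then show ?thesis using that Hinf_subset_H2 by (auto simp: H2_dist_def Hinf_dist_def)
  qed
  have "continuous_map (Hinf_top (Hol_n n)) (Hinf_top outer_functions) Q_out"
    unfolding Hinf_top_def
    by (rule continuous_map_from_sequences[OF spaces(1,2) img(2)]) (rule Q_sequentially_continuous(1))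
  moreover have "continuous_map (Hinf_top (Hol_n n)) (H2_top inner_functions) Q_inn"
    unfolding Hinf_top_def H2_top_def
    by (rule continuous_map_from_sequences[OF spaces(1,3) img(1)]) (rule Q_sequentially_continuous(2))
  moreover have "continuous_map (Hinf_top (Hol_n n)) (H2_top outer_functions) Q_out"
    unfolding Hinf_top_def H2_top_def
  proof (rule continuous_map_from_sequences[OF spaces(1,4) img(2)])
    fix f e and fs :: "nat \<Rightarrow> complex \<Rightarrow> complex"
    assume f: "f \<in> Hol_n n" "\<And>k. fs k \<in> Hol_n n" "(\<lambda>k. Hinf_dist f (fs k)) \<longlonglongrightarrow> 0" "(e::real) > 0"
    have "Q_out f \<in> Hinf" "Q_out (fs k) \<in> Hinf" for k
      using img(2) f(1,2) subsets_of_Hinf(2) by blast+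
    note le' = le[OF this]
    show "\<forall>\<^sub>F k in sequentially. H2_dist (Q_out f) (Q_out (fs k)) < e"
      using Q_sequentially_continuous(1)[OF f]
      by eventually_elim (use le' in \<open>auto intro: le_less_trans\<close>)
  qed
  ultimately show ?thesis using Q_inn_not_continuous by blast
qed

end
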